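(* Let $B^{(n)}$, $Q^{(n)}$, $J$ be associated with $(\mu,\vec w,\vec n)$ as in the context. (1) Assume that $J$ is nonnegative, that $b(B)<\infty$ and $b(B)\notin\mathscr Z(B)$, and let $\lambda\ge b(B)$. For the Markov chain with stochastic matrix $P_{II}=\frac1\lambda\sigma_{II}J\sigma_{II}^{-1}$, $\sigma_{II}=\operatorname{diag}(1/B^{(n)}(\lambda))_{n\ge0}$, and for $|s|<1$, the transition probability generating function is $$P_{II,nm}(s)=\frac{B^{(m)}(\lambda)}{B^{(n)}(\lambda)}\int_\Delta\frac{B^{(n)}(x)Q^{(m)}(x)}{1-\frac s\lambda x}\,d\mu(x),$$ while for the first passage generating function $$F_{II,nm}(s)=\frac{B^{(m)}(\lambda)}{B^{(n)}(\lambda)}\;\frac{\displaystyle\int_\Delta\frac{B^{(n)}(x)Q^{(m)}(x)}{1-\frac s\lambda x}\,d\mu(x)}{\displaystyle\int_\Delta\frac{B^{(m)}(x)Q^{(m)}(x)}{1-\frac s\lambda x}\,d\mu(x)}\quad(n\ne m),\qquad F_{nn}(s)=1-\frac{1}{\displaystyle\int_\Delta\frac{B^{(n)}(x)Q^{(n)}(x)}{1-\frac s\lambda x}\,d\mu(x)}.$$ (2) Assume that $J$ is nonnegative, that $b(Q)<\infty$, $b(Q)\notin\mathscr Z(Q)$, and that $\lim_{x\to+\infty}Q^{(n)}(x)=+\infty$ (for $n\in\mathbb N_0$), and let $\lambda\ge\max(b(Q),0)$. For the Markov chain with stochastic matrix $P_I=\frac1\lambda\sigma_IJ^\top\sigma_I^{-1}$,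 $\sigma_I=\operatorname{diag}(1/Q^{(n)}(\lambda))_{n\ge0}$, and for $|s|<1$, the transition probability generating function is $$P_{I,nm}(s)=\frac{Q^{(m)}(\lambda)}{Q^{(n)}(\lambda)}\int_\Delta\frac{B^{(m)}(x)Q^{(n)}(x)}{1-\frac s\lambda x}\,d\mu(x),$$ while for the first passage generating function $$F_{I,nm}(s)=\frac{Q^{(m)}(\lambda)}{Q^{(n)}(\lambda)}\;\frac{\displaystyle\int_\Delta\frac{B^{(m)}(x)Q^{(n)}(x)}{1-\frac s\lambda x}\,d\mu(x)}{\displaystyle\int_\Delta\frac{B^{(m)}(x)Q^{(m)}(x)}{1-\frac s\lambda x}\,d\mu(x)}\quad(n\ne m),\qquad F_{nn}(s)=1-\frac{1}{\displaystyle\int_\Delta\frac{B^{(n)}(x)Q^{(n)}(x)}{1-\frac s\lambda x}\,d\mu(x)}.$$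
   Context: General setting. $\Delta\subset\mathbb R$ is an interval, $\mu$ is a finite Borel measure on $\Delta$ that does not change sign and whose support has infinitely many points, $w_1,\dots,w_p$ are weights on $\Delta$ (real integrable functions that do not change sign on $\Delta$), and $\vec n=(n_1,\dots,n_p)$ is a vector of positive integers, $|\vec n|=n_1+\dots+n_p$. Every $i\in\mathbb N_0$ is written uniquely as $i=q(i)|\vec n|+n_1+\dots+n_{a(i)-1}+r(i)$ with $q(i)\in\mathbb N_0$, $a(i)\in\{1,\dots,p\}$, $0\le r(i)<n_{a(i)}$; put $k(i)=q(i)n_{a(i)}+r(i)$ and $\xi^{(i)}(x)=x^{k(i)}w_{a(i)}(x)$. The pair $(\mu,\vec w)$ is assumed perfect; in particular all leading principal minors of the moment matrix $g_{i,j}=\int_\Delta x^i\xi^{(j)}(x)\,d\mu(x)$ are nonzero. Then: - $B^{(l)}$ is the unique monic polynomial of degree $l$ with $\int_\Delta B^{(l)}\xi^{(j)}\,d\mu=0$ for $0\le j<l$ (type II multiple orthogonal polynomial); - $Q^{(l)}(x)=\sum_{a=1}^pA^{(l)}_a(x) w_a(x)$, with polynomials $A^{(l)}_a$, is the unique real linear combination of $\xi^{(0)},\dots,\xi^{(l)}$ with $\int_\Delta x^iQ^{(l)}(x)\,d\mu(x)=\delta_{i,l}$ for $0\le i\le l$ (type I linear form); the same expression gives its value at points $x$ outside $\Delta$; - the Jacobi matrix $J=(J_{n,m})_{n,m\in\mathbb N_0}$ is defined by $xB^{(n)}(x)=\sum_m J_{n,m}B^{(m)}(x)$. With $N:=\max_a(|\vec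 n|-n_a+1)$ one has $J_{n,n+1}=1$ and $J_{n,m}=0$ unless $n-N\le m\le n+1$. $\mathscr Z(B)\subset\mathbb C$ (resp. $\mathscr Z(Q)\subset\mathbb C$) is the union over $n\in\mathbb N_0$ of the sets of zeros of $B^{(n)}$ (resp. $Q^{(n)}$), and $b(B)$, $b(Q)$ are the suprema of the absolute values of their elements. Under the respective assumptions $P_{II}$ and $P_I$ are stochastic matrices. For a Markov chain $(X_k)$ on $\mathbb N_0$ with stochastic matrix $P$: $P_{nm}(s)=\sum_{r=0}^\infty (P^r)_{n,m}s^r$ and $F_{nm}(s)=\sum_{r=1}^\infty f^r_{nm}s^r$, where $f^r_{nm}=\Pr[X_r=m,X_{r-1}\ne m,\dots,X_1\neq m\mid X_0=n]$ is the first-passage-time probability ($f^1_{nm}=P_{nm}$). A subscript $II$ or $I$ indicates the chain with matrix $P_{II}$ or $P_I$; in each part $F_{nn}$ refers to the chain of that part. *)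

theory Defs
  imports "HOL-Probability.Probability" "HOL-Computational_Algebra.Polynomial"
begin

subsection \<open>Measures and weights\<close>

text \<open>A Borel measure of constant sign is represented as \<open>\<epsilon> M\<close>, where \<open>M\<close> is a nonnegative measure
  and \<open>\<epsilon> = 1\<close> or \<open>\<epsilon> = -1\<close>; the following is the integral against it.\<close>

definition sint :: "real \<Rightarrow> real measure \<Rightarrow> (real \<Rightarrow> 'b) \<Rightarrow> 'b::{banach, second_countable_topology}" where
  "sint \<epsilon> M f = \<epsilon> *\<^sub>R (\<integral>x. f x \<partial>M)"

definition msupport :: "real measure \<Rightarrow> real set" where
  "msupport M = {x \<in> space M. \<forall>U. open U \<and> x \<in> U \<longrightarrow> emeasure M (U \<inter> space M) \<noteq> 0}"

definition no_sign_change_on :: "real set \<Rightarrow> (real \<Rightarrow> real) \<Rightarrow> bool" where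
  "no_sign_change_on S f \<longleftrightarrow> (\<forall>x\<in>S. 0 \<le> f x) \<or> (\<forall>x\<in>S. f x \<le> 0)"

text \<open>Multi-indices are functions of which only the values on \<open>{1..p}\<close> matter.\<close>

definition msize :: "nat \<Rightarrow> (nat \<Rightarrow> nat) \<Rightarrow> nat" where
  "msize p \<nu> = (\<Sum>a=1..p. \<nu> a)"

definition normal_index ::
  "real \<Rightarrow> real measure \<Rightarrow> nat \<Rightarrow> (nat \<Rightarrow> real \<Rightarrow> real) \<Rightarrow> (nat \<Rightarrow> nat) \<Rightarrow> bool" where
  "normal_index \<epsilon> M p w \<nu> \<longleftrightarrow>
     (\<forall>B :: real poly. B \<noteq> 0 \<and> degree B \<le> msize p \<nu> \<and>
        (\<forall>a\<in>{1..p}. \<forall>i<\<nu> a. sint \<epsilon> M (\<lambda>x. x ^ i * poly B x * w a x) = 0)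
        \<longrightarrow> degree B = msize p \<nu>)"

definition perfect ::
  "real \<Rightarrow> real measure \<Rightarrow> nat \<Rightarrow> (nat \<Rightarrow> real \<Rightarrow> real) \<Rightarrow> bool" where
  "perfect \<epsilon> M p w \<longleftrightarrow> (\<forall>\<nu>. normal_index \<epsilon> M p w \<nu>)"


subsection \<open>The step-line ordering\<close>

definition is_decomp :: "nat \<Rightarrow> (nat \<Rightarrow> nat) \<Rightarrow> nat \<Rightarrow> nat \<times> nat \<times> nat \<Rightarrow> bool" where
  "is_decomp p nv i = (\<lambda>(q, a, r). a \<in> {1..p} \<and> r < nv a \<and>
     i = q * msize p nv + (\<Sum>b=1..<a. nv b) + r)"

definition decomp :: "nat \<Rightarrow> (nat \<Rightarrow> nat) \<Rightarrow> nat \<Rightarrow> nat \<times> nat \<times> nat" where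
  "decomp p nv i = (THE t. is_decomp p nv i t)"

definition idx_q :: "nat \<Rightarrow> (nat \<Rightarrow> nat) \<Rightarrow> nat \<Rightarrow> nat" where
  "idx_q p nv i = fst (decomp p nv i)"

definition idx_a :: "nat \<Rightarrow> (nat \<Rightarrow> nat) \<Rightarrow> nat \<Rightarrow> nat" where
  "idx_a p nv i = fst (snd (decomp p nv i))"

definition idx_r :: "nat \<Rightarrow> (nat \<Rightarrow> nat) \<Rightarrow> nat \<Rightarrow> nat" where
  "idx_r p nv i = snd (snd (decomp p nv i))"

definition idx_k :: "nat \<Rightarrow> (nat \<Rightarrow> nat) \<Rightarrow> nat \<Rightarrow> nat" where
  "idx_k p nv i = idx_q p nv i * nv (idx_a p nv i) + idx_r p nv i"

definition xi :: "nat \<Rightarrow> (nat \<Rightarrow> nat) \<Rightarrow> (nat \<Rightarrow> real \<Rightarrow> real) \<Rightarrow> nat \<Rightarrow> real \<Rightarrow> real" where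
  "xi p nv w i x = x ^ idx_k p nv i * w (idx_a p nv i) x"

lemma decomp_ex1:
  assumes "1 \<le> p" and pos: "\<And>a. a \<in> {1..p} \<Longrightarrow> 0 < nv a"
  shows "\<exists>!t. is_decomp p nv i t"
proof -
  let ?N = "msize p nv" and ?S = "\<lambda>a. \<Sum>b=1..<a. nv b"
  have S_Suc: "?S (Suc a) = ?S a + nv a" if "1 \<le> a" for a
    using that by simp
  have S_mono: "?S a \<le> ?S b" if "a \<le> b" for a b
    using that by (intro sum_mono2) auto
  have N_S: "?N = ?S (Suc p)"
    by (simp add: msize_def atLeastLessThanSuc_atLeastAtMost)
  have "nv 1 \<le> ?N"
    using S_mono[of "Suc 1" "Suc p"] assms(1) by (simp add: N_S)
  with pos[of 1] assms(1) have N_pos: "0 < ?N" by simp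
  have bound: "?S a + r < ?N" if "a \<in> {1..p}" "r < nv a" for a r
  proof -
    have "?S a + r < ?S (Suc a)" using that S_Suc[of a] by simp
    also have "\<dots> \<le> ?N" unfolding N_S using that by (intro S_mono) simp
    finally show ?thesis .
  qed
  define a where "a = (LEAST a. i mod ?N < ?S (Suc a))"
  have "i mod ?N < ?S (Suc p)" unfolding N_S[symmetric] using N_pos by simp
  then have a_lt: "i mod ?N < ?S (Suc a)" and a_le: "a \<le> p"
    unfolding a_def by (rule LeastI, rule Least_le)
  have a1: "1 \<le> a" using a_lt by (cases a) auto
  have a_ge: "?S a \<le> i mod ?N"
    using not_less_Least[of "a - 1" "\<lambda>a. i mod ?N < ?S (Suc a)"] a1
    unfolding a_def[symmetric] by simp
  show ?thesis
  proof (rule ex1I)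
    show "is_decomp p nv i (i div ?N, a, i mod ?N - ?S a)"
      using a1 a_le a_lt a_ge S_Suc[OF a1] div_mult_mod_eq[of i ?N]
      by (simp add: is_decomp_def less_diff_conv2 add.commute)
  next
    fix t assume "is_decomp p nv i t"
    then obtain q c r where t: "t = (q, c, r)" and c: "c \<in> {1..p}" "r < nv c"
      and i: "i = q * ?N + ?S c + r"
      by (cases t) (auto simp: is_decomp_def)
    have i': "i = (?S c + r) + q * ?N" using i by simp
    have q: "q = i div ?N" unfolding i' using bound[OF c] by simp
    have m: "i mod ?N = ?S c + r" unfolding i' using bound[OF c] by simp
    have "c = a"
    proof (rule antisym)
      show "c \<le> a"
        using S_mono[of "Suc a" c] a_lt m by (rule_tac ccontr) simp
      show "a \<le> c"
        using c m S_Suc[of c] by (auto simp: a_def intro!: Least_le)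
    qed
    then show "t = (i div ?N, a, i mod ?N - ?S a)" using t q m by simp
  qed
qed


subsection \<open>Multiple orthogonal polynomials and the Jacobi matrix\<close>

definition typeII_B ::
  "real \<Rightarrow> real measure \<Rightarrow> nat \<Rightarrow> (nat \<Rightarrow> nat) \<Rightarrow> (nat \<Rightarrow> real \<Rightarrow> real) \<Rightarrow> nat \<Rightarrow> real poly" where
  "typeII_B \<epsilon> M p nv w l = (THE B. degree B = l \<and> lead_coeff B = 1 \<and>
     (\<forall>j<l. sint \<epsilon> M (\<lambda>x. poly B x * xi p nv w j x) = 0))"

text \<open>Coefficients of the linear form of index \<open>l\<close> with respect to \<open>\<xi>\<^sup>0, \<dots>, \<xi>\<^sup>l\<close>.\<close>

definition typeI_coeff ::
  "real \<Rightarrow> real measure \<Rightarrow> nat \<Rightarrow> (nat \<Rightarrow> nat) \<Rightarrow> (nat \<Rightarrow> real \<Rightarrow> real) \<Rightarrow> nat \<Rightarrow> nat \<Rightarrow> real" where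
  "typeI_coeff \<epsilon> M p nv w l = (THE c. (\<forall>j>l. c j = 0) \<and>
     (\<forall>i\<le>l. sint \<epsilon> M (\<lambda>x. x ^ i * (\<Sum>j\<le>l. c j * xi p nv w j x)) = (if i = l then 1 else 0)))"

definition typeI_A ::
  "real \<Rightarrow> real measure \<Rightarrow> nat \<Rightarrow> (nat \<Rightarrow> nat) \<Rightarrow> (nat \<Rightarrow> real \<Rightarrow> real) \<Rightarrow> nat \<Rightarrow> nat \<Rightarrow> real poly" where
  "typeI_A \<epsilon> M p nv w l a =
     (\<Sum>j | j \<le> l \<and> idx_a p nv j = a. monom (typeI_coeff \<epsilon> M p nv w l j) (idx_k p nv j))"

definition typeI_Q ::
  "real \<Rightarrow> real measure \<Rightarrow> nat \<Rightarrow> (nat \<Rightarrow> nat) \<Rightarrow> (nat \<Rightarrow> real \<Rightarrow> real) \<Rightarrow> nat \<Rightarrow> real \<Rightarrow> real" where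
  "typeI_Q \<epsilon> M p nv w l x = (\<Sum>a=1..p. poly (typeI_A \<epsilon> M p nv w l a) x * w a x)"

definition Jacobi :: "(nat \<Rightarrow> real poly) \<Rightarrow> nat \<Rightarrow> nat \<Rightarrow> real" where
  "Jacobi B n = (THE c. finite {m. c m \<noteq> 0} \<and>
     [:0, 1:] * B n = (\<Sum>m | c m \<noteq> 0. smult (c m) (B m)))"


subsection \<open>Zeros\<close>

definition zeros_B :: "(nat \<Rightarrow> real poly) \<Rightarrow> complex set" where
  "zeros_B B = (\<Union>n. {z. poly (map_poly complex_of_real (B n)) z = 0})"

text \<open>The polynomials of the linear form have real coefficients, but the weights are only functions:
  its complex zeros refer to values \<open>wc a z\<close> of the weights at the points \<open>z\<close> of a set \<open>D\<close>, on which
  the expressions that define the weights make sense.\<close>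

definition zeros_Q ::
  "nat \<Rightarrow> (nat \<Rightarrow> nat \<Rightarrow> real poly) \<Rightarrow> (nat \<Rightarrow> complex \<Rightarrow> complex) \<Rightarrow> complex set \<Rightarrow> complex set" where
  "zeros_Q p A wc D =
     (\<Union>n. {z \<in> D. (\<Sum>a=1..p. poly (map_poly complex_of_real (A n a)) z * wc a z) = 0})"

text \<open>The value is \<open>-\<infinity>\<close> for the empty set.\<close>

definition sup_abs :: "complex set \<Rightarrow> ereal" where
  "sup_abs Z = (SUP z\<in>Z. ereal (cmod z))"


subsection \<open>Markov chains on the natural numbers\<close>

definition stochastic :: "(nat \<Rightarrow> nat \<Rightarrow> real) \<Rightarrow> bool" where
  "stochastic P \<longleftrightarrow> (\<forall>n m. 0 \<le> P n m) \<and> (\<forall>n. P n sums 1)"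

fun imat_pow :: "(nat \<Rightarrow> nat \<Rightarrow> real) \<Rightarrow> nat \<Rightarrow> nat \<Rightarrow> nat \<Rightarrow> real" where
  "imat_pow P 0 n m = (if n = m then 1 else 0)"
| "imat_pow P (Suc r) n m = (\<Sum>k. P n k * imat_pow P r k m)"

text \<open>The initial distribution is arbitrary.\<close>

definition markov_chain :: "'a measure \<Rightarrow> (nat \<Rightarrow> 'a \<Rightarrow> nat) \<Rightarrow> (nat \<Rightarrow> nat \<Rightarrow> real) \<Rightarrow> bool" where
  "markov_chain \<Omega> X P \<longleftrightarrow> prob_space \<Omega> \<and> (\<forall>k. X k \<in> measurable \<Omega> (count_space UNIV)) \<and>
     (\<forall>k i j. \<P>(\<omega> in \<Omega>. \<forall>l\<le>k. X l \<omega> = i l) > 0 \<longrightarrow>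
        \<P>(\<omega> in \<Omega>. X (Suc k) \<omega> = j \<bar> \<forall>l\<le>k. X l \<omega> = i l) = P (i k) j)"

definition first_passage :: "'a measure \<Rightarrow> (nat \<Rightarrow> 'a \<Rightarrow> nat) \<Rightarrow> nat \<Rightarrow> nat \<Rightarrow> nat \<Rightarrow> real" where
  "first_passage \<Omega> X r n m =
     \<P>(\<omega> in \<Omega>. X r \<omega> = m \<and> (\<forall>k\<in>{1..<r}. X k \<omega> \<noteq> m) \<bar> X 0 \<omega> = n)"

definition transition_gf :: "(nat \<Rightarrow> nat \<Rightarrow> real) \<Rightarrow> nat \<Rightarrow> nat \<Rightarrow> complex \<Rightarrow> complex" where
  "transition_gf P n m s = (\<Sum>r. complex_of_real (imat_pow P r n m) * s ^ r)"

definition first_passage_gf ::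
  "'a measure \<Rightarrow> (nat \<Rightarrow> 'a \<Rightarrow> nat) \<Rightarrow> nat \<Rightarrow> nat \<Rightarrow> complex \<Rightarrow> complex" where
  "first_passage_gf \<Omega> X n m s =
     (\<Sum>r. complex_of_real (first_passage \<Omega> X (Suc r) n m) * s ^ Suc r)"

text \<open>Entries of \<open>(1/lam) \<sigma> A \<sigma>\<^sup>-\<^sup>1\<close> for the diagonal matrix \<open>\<sigma>\<close> with entries \<open>\<sigma> n\<close>.\<close>

definition scaled_conj ::
  "real \<Rightarrow> (nat \<Rightarrow> real) \<Rightarrow> (nat \<Rightarrow> nat \<Rightarrow> real) \<Rightarrow> nat \<Rightarrow> nat \<Rightarrow> real" where
  "scaled_conj lam \<sigma> A n m = 1 / lam * (\<sigma> n * A n m * inverse (\<sigma> m))"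

definition P_II :: "(nat \<Rightarrow> real poly) \<Rightarrow> real \<Rightarrow> nat \<Rightarrow> nat \<Rightarrow> real" where
  "P_II B lam = scaled_conj lam (\<lambda>n. 1 / poly (B n) lam) (Jacobi B)"

definition P_I :: "(nat \<Rightarrow> real poly) \<Rightarrow> (nat \<Rightarrow> real \<Rightarrow> real) \<Rightarrow> real \<Rightarrow> nat \<Rightarrow> nat \<Rightarrow> real" where
  "P_I B Q lam = scaled_conj lam (\<lambda>n. 1 / Q n lam) (\<lambda>n m. Jacobi B m n)"

end

theory Submission
  imports Defs
begin

text \<open>The linear forms \<open>Q\<^sup>m\<close> are dual to the basis \<open>B\<^sup>n\<close>, so that
  \<open>(J\<^sup>r)\<^sub>n\<^sub>m = \<integral> x\<^sup>r B\<^sup>n Q\<^sup>m d\<mu>\<close>, and \<open>P\<^sup>r\<close> is \<open>lam\<^sup>-\<^sup>r\<close> times a diagonal conjugate of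
  \<open>J\<^sup>r\<close> or of its transpose. The formula for the transition generating function is then a
  geometric series under the integral sign, which requires that \<open>B\<^sup>n Q\<^sup>m\<close> vanishes
  \<open>\<mu>\<close>-almost everywhere outside \<open>[-lam, lam]\<close>. This is not clear from the zeros, but
  follows from stochasticity: the entries of \<open>P\<^sup>r\<close> are at most 1, so the moments of order \<open>r\<close> of
  each \<open>w\<^sub>a d\<mu>\<close> are \<open>O(lam\<^sup>r)\<close>, and since \<open>w\<^sub>a d\<mu>\<close> has constant sign, it lives on
  \<open>[-lam, lam]\<close>. The first passage generating functions come from the renewal equation
  \<open>P\<^sub>n\<^sub>m(s) = \<delta>\<^sub>n\<^sub>m + F\<^sub>n\<^sub>m(s) P\<^sub>m\<^sub>m(s)\<close>. The first passage
  probabilities in it are defined from the matrix alone, because \<open>P\<^sub>m\<^sub>m(s) \<noteq> 0\<close> is needed also for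
  states \<open>m\<close> in which the given chain does not start.\<close>

subsection \<open>Biorthogonal systems for a sequence of linear functionals\<close>

text \<open>Models the functionals f -> integral of f xi^(j) dmu. The assumption
  \<open>normal\<close> says that every leading principal minor of the matrix of the values
  \<open>L j\<close> on x^i is nonzero.\<close>

locale normal_functionals =
  fixes L :: "nat \<Rightarrow> real poly \<Rightarrow> real"
  assumes L_add: "L j (f + g) = L j f + L j g"
    and L_smult: "L j (smult c f) = c * L j f"
    and normal: "f \<noteq> 0 \<Longrightarrow> (\<And>j. j < l \<Longrightarrow> L j f = 0) \<Longrightarrow> l \<le> degree f"
begin

section \<open>Type II polynomials: existence, uniqueness, spanning\<close>

definition typeII_spec :: "nat \<Rightarrow> real poly \<Rightarrow> bool" where
  "typeII_spec l f \<longleftrightarrow> degree f = l \<and> lead_coeff f = 1 \<and> (\<forall>j<l. L j f = 0)"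

lemma L_diff: "L j (f - g) = L j f - L j g"
proof -
  have "f - g = f + smult (-1) g" by simp
  then show ?thesis unfolding L_add L_smult by (metis L_add L_smult mult_minus1 uminus_add_conv_diff add.commute)
qed

lemma L_zero: "L j 0 = 0"
  using L_smult[of j 0 0] by simp

lemma L_sum: "L j (sum f I) = (\<Sum>i\<in>I. L j (f i))"
  by (induction I rule: infinite_finite_induct) (auto simp: L_zero L_add)

text \<open>Otherwise l + 1 functionals would annihilate a nonzero polynomial of degree l. These
  values are the pivots of every elimination below.\<close>

lemma typeII_spec_diag_nonzero:
  assumes "typeII_spec l f" shows "L l f \<noteq> 0"
proof
  assume "L l f = 0"
  then have "L j f = 0" if "j < Suc l" for j
    using assms that unfolding typeII_spec_def by (cases "j = l") auto
  moreover have "f \<noteq> 0" using assms unfolding typeII_spec_def by auto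
  ultimately have "Suc l \<le> degree f" by (intro normal)
  then show False using assms unfolding typeII_spec_def by simp
qed

text \<open>Gram-Schmidt: starting from x^l, the functionals of index 0, 1, ..., l - 1 are killed
  one at a time by subtracting multiples of lower type II polynomials.\<close>

lemma typeII_spec_ex: "\<exists>f. typeII_spec l f"
proof (induction l rule: less_induct)
  case (less l)
  have "\<exists>f. degree f = l \<and> lead_coeff f = 1 \<and> (\<forall>j<k. L j f = 0)" if "k \<le> l" for k
    using that
  proof (induction k)
    case 0
    show ?case by (intro exI[of _ "monom 1 l"]) (auto simp: degree_monom_eq)
  next
    case (Suc k)
    then obtain f where f: "degree f = l" "lead_coeff f = 1" "\<forall>j<k. L j f = 0" by auto
    obtain g where g: "typeII_spec k g" using less[of k] Suc.prems by auto
    \<comment> \<open>Subtracting a multiple of \<open>g\<close> kills \<open>L k\<close> and leaves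
      \<open>L j\<close> for j < k at zero, since \<open>g\<close> is orthogonal to these; the
      leading term survives because k < l.\<close>
    define h where "h = f - smult (L k f / L k g) g"
    have dg: "degree (smult (L k f / L k g) g) < l"
      using g Suc.prems degree_smult_le[of "L k f / L k g" g] unfolding typeII_spec_def by linarith
    have "degree h \<le> l" unfolding h_def using f dg by (intro degree_diff_le) auto
    moreover have "coeff h l = 1" unfolding h_def using f dg by (simp add: coeff_eq_0 del: coeff_smult)
    ultimately have "degree h = l" "lead_coeff h = 1"
      by (metis le_antisym le_degree zero_neq_one)+
    moreover have "L j h = 0" if "j < Suc k" for j
      using f g that typeII_spec_diag_nonzero[OF g]
      unfolding h_def L_diff L_smult typeII_spec_def by (cases "j = k") auto
    ultimately show ?case by blast
  qed
  from this[of l] show ?case unfolding typeII_spec_def by auto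
qed

text \<open>The leading terms cancel in the difference, so its degree drops below l although l
  functionals annihilate it.\<close>

lemma typeII_spec_unique:
  assumes "typeII_spec l f" "typeII_spec l g" shows "f = g"
proof (rule ccontr)
  assume "f \<noteq> g"
  then have "l \<le> degree (f - g)"
    using assms by (intro normal) (auto simp: L_diff typeII_spec_def)
  moreover have "degree (f - g) \<le> l"
    using assms by (intro degree_diff_le) (auto simp: typeII_spec_def)
  moreover have "coeff (f - g) l = 0" using assms by (auto simp: typeII_spec_def)
  ultimately show False using \<open>f \<noteq> g\<close> by (metis le_antisym leading_coeff_0_iff right_minus_eq)
qed

definition B :: "nat \<Rightarrow> real poly" where
  "B l = (THE f. typeII_spec l f)"

lemma typeII_spec_B: "typeII_spec l (B l)"
  unfolding B_def using typeII_spec_ex typeII_spec_unique by (metis theI)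

lemma degree_B: "degree (B l) = l" and coeff_B: "coeff (B l) l = 1"
  and L_B_less: "j < l \<Longrightarrow> L j (B l) = 0" and L_B_diag: "L l (B l) \<noteq> 0"
  using typeII_spec_B[of l] typeII_spec_diag_nonzero[OF typeII_spec_B[of l]]
  by (auto simp: typeII_spec_def)

lemma B_span: "degree f \<le> n \<Longrightarrow> \<exists>c. f = (\<Sum>k\<le>n. smult (c k) (B k))"
proof (induction n arbitrary: f)
  case 0
  have "B 0 = 1" using degree_B[of 0] coeff_B[of 0]
    by (metis degree_eq_zeroE coeff_pCons_0 one_pCons)
  moreover obtain a where "f = [:a:]" using 0 by (metis degree_eq_zeroE le_zero_eq)
  ultimately show ?case by (intro exI[of _ "\<lambda>_. a"]) (simp add: one_pCons)
next
  case (Suc n)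
  let ?a = "coeff f (Suc n)"
  define g where "g = f - smult ?a (B (Suc n))"
  have "degree g \<le> Suc n" unfolding g_def using Suc.prems degree_B[of "Suc n"]
    by (intro degree_diff_le) (auto intro: order_trans[OF degree_smult_le])
  moreover have "coeff g (Suc n) = 0" unfolding g_def using coeff_B[of "Suc n"] by simp
  ultimately have "degree g \<le> n"
    by (metis coeff_0 leading_coeff_0_iff le_SucE degree_0 le0)
  from Suc.IH[OF this] obtain c where c: "g = (\<Sum>k\<le>n. smult (c k) (B k))" by auto
  have "f = g + smult ?a (B (Suc n))" by (simp add: g_def)
  also have "\<dots> = (\<Sum>k\<le>Suc n. smult ((c(Suc n := ?a)) k) (B k))"
    by (simp add: c)
  finally show ?case by blast
qed

section \<open>Type I linear forms, seen as functionals on polynomials\<close>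

definition comb :: "nat \<Rightarrow> (nat \<Rightarrow> real) \<Rightarrow> real poly \<Rightarrow> real" where
  "comb l c f = (\<Sum>j\<le>l. c j * L j f)"

lemma comb_smult: "comb l c (smult a f) = a * comb l c f"
  and comb_sum: "comb l c (sum h I) = (\<Sum>i\<in>I. comb l c (h i))"
  by (simp_all add: comb_def L_smult L_sum sum_distrib_left sum.distrib algebra_simps
      sum.swap[of _ I])

definition typeI_spec :: "nat \<Rightarrow> (nat \<Rightarrow> real) \<Rightarrow> bool" where
  "typeI_spec l c \<longleftrightarrow> (\<forall>j>l. c j = 0) \<and> (\<forall>i\<le>l. comb l c (monom 1 i) = (if i = l then 1 else 0))"

lemma comb_eq_coeff:
  assumes "typeI_spec l c" "degree f \<le> l" shows "comb l c f = coeff f l"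
proof -
  have "f = (\<Sum>i\<le>l. monom (coeff f i) i)"
    using assms(2) by (simp add: poly_as_sum_of_monoms')
  also have "\<dots> = (\<Sum>i\<le>l. smult (coeff f i) (monom 1 i))" by (simp add: smult_monom)
  finally have "comb l c f = (\<Sum>i\<le>l. coeff f i * comb l c (monom 1 i))"
    by (metis (no_types, lifting) comb_smult comb_sum sum.cong)
  also have "\<dots> = (\<Sum>i\<le>l. if i = l then coeff f l else 0)"
    using assms(1) by (intro sum.cong) (auto simp: typeI_spec_def)
  also have "\<dots> = coeff f l" by simp
  finally show ?thesis .
qed

text \<open>Biorthogonality. For k <= l it is the coefficient of degree l that is read off; for k >
  l every term vanishes by orthogonality of \<open>B k\<close>.\<close>

lemma comb_B:
  assumes "typeI_spec l c" shows "comb l c (B k) = (if k = l then 1 else 0)"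
proof (cases "k \<le> l")
  case True
  then show ?thesis using comb_eq_coeff[OF assms, of "B k"] degree_B[of k] coeff_B[of k]
    by (auto simp: coeff_eq_0)
next
  case False
  then show ?thesis by (auto simp: comb_def L_B_less intro!: sum.neutral)
qed

text \<open>The conditions on the values at \<open>B i\<close> form a triangular system, as
  \<open>L j (B i)\<close> = 0 for j < i, with nonzero diagonal. It is solved by back substitution
  from i = l downwards, \<open>d\<close> counting the equations below l already satisfied.\<close>

lemma typeI_spec_ex: "\<exists>c. typeI_spec l c"
proof -
  have "\<exists>c. (\<forall>j>l. c j = 0) \<and> comb l c (B l) = 1 \<and> (\<forall>i. l - d \<le> i \<and> i < l \<longrightarrow> comb l c (B i) = 0)"
    if "d \<le> l" for d
    using that
  proof (induction d)
    case 0
    have "comb l (\<lambda>j. if j = l then 1 / L l (B l) else 0) (B l)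
        = (\<Sum>j\<le>l. if j = l then 1 else 0)"
      unfolding comb_def using L_B_diag[of l] by (intro sum.cong) auto
    then show ?case by (intro exI[of _ "\<lambda>j. if j = l then 1 / L l (B l) else 0"]) auto
  next
    case (Suc d)
    then obtain c where c: "\<forall>j>l. c j = 0" "comb l c (B l) = 1"
      "\<forall>i. l - d \<le> i \<and> i < l \<longrightarrow> comb l c (B i) = 0" by auto
    define k where "k = l - Suc d"
    have k: "k < l" "l - d = Suc k" using Suc.prems by (auto simp: k_def)
    \<comment> \<open>Changing the coefficient of index k corrects the value at \<open>B k\<close>
      and does not disturb the values at \<open>B i\<close> with i > k, where \<open>L k\<close>
      vanishes.\<close>
    define t where "t = comb l c (B k) / L k (B k)"
    have upd: "comb l (\<lambda>j. c j - (if j = k then t else 0)) f = comb l c f - t * L k f" for f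
    proof -
      have "comb l (\<lambda>j. c j - (if j = k then t else 0)) f
          = (\<Sum>j\<le>l. c j * L j f - (if j = k then t * L k f else 0))"
        unfolding comb_def by (intro sum.cong) (auto simp: algebra_simps)
      also have "\<dots> = comb l c f - t * L k f"
        using k by (simp add: comb_def sum_subtractf)
      finally show ?thesis .
    qed
    have "comb l c (B i) - t * L k (B i) = 0" if "l - Suc d \<le> i" "i < l" for i
    proof (cases "i = k")
      case True
      then show ?thesis using L_B_diag[of k] by (simp add: t_def)
    next
      case False
      then have "k < i" using that by (simp add: k_def)
      then show ?thesis using c(3) that k L_B_less by auto
    qed
    then show ?case
      using c k L_B_less[of k l]
      by (intro exI[of _ "\<lambda>j. c j - (if j = k then t else 0)"]) (auto simp: upd)
  qed
  from this[of l] obtain c where c: "\<forall>j>l. c j = 0" "comb l c (B l) = 1"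
    "\<And>i. i < l \<Longrightarrow> comb l c (B i) = 0" by auto
  \<comment> \<open>Back from the \<open>B k\<close> to monomials: in the expansion of x^i with i <=
    l, the coefficient of \<open>B l\<close> is the coefficient of degree l.\<close>
  have "comb l c (monom 1 i) = (if i = l then 1 else 0)" if "i \<le> l" for i
  proof -
    have "degree (monom (1::real) i) \<le> l" using that by (simp add: degree_monom_eq)
    then obtain d where d: "monom 1 i = (\<Sum>k\<le>l. smult (d k) (B k))" using B_span by blast
    have "coeff (monom (1::real) i) l = (\<Sum>k\<le>l. if k = l then d l else 0)"
      unfolding d coeff_sum using coeff_B[of l] degree_B
      by (intro sum.cong) (auto simp: coeff_eq_0)
    then have dl: "d l = (if i = l then 1 else 0)" by (auto split: if_splits)
    have "comb l c (monom 1 i) = (\<Sum>k\<le>l. if k = l then d l else 0)"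
      unfolding d comb_sum comb_smult using c(2,3) by (intro sum.cong) auto
    then show ?thesis using dl by simp
  qed
  then show ?thesis using c(1) by (auto simp: typeI_spec_def)
qed

lemma typeI_spec_unique:
  assumes c: "typeI_spec l c" and d: "typeI_spec l d" shows "c = d"
proof -
  define e where "e j = c j - d j" for j
  have e0: "(\<Sum>j\<le>l. e j * L j (B i)) = 0" for i
    using comb_B[OF c, of i] comb_B[OF d, of i]
    by (simp add: comb_def e_def left_diff_distrib sum_subtractf)
  have "e j = 0" for j
  \<comment> \<open>Descending induction on j: tested against \<open>B j\<close>, the terms above j
    vanish by induction and those below j by orthogonality, which isolates
    \<open>e j\<close>.\<close>
  proof (induction "l - j" arbitrary: j rule: less_induct)
    case less
    show ?case
    proof (cases "j \<le> l")
      case True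
      have "e i * L i (B j) = (if i = j then e j * L j (B j) else 0)" if "i \<le> l" for i
        using less[of i] L_B_less[of i j] that by (cases i j rule: linorder_cases) auto
      then have "(\<Sum>i\<le>l. e i * L i (B j)) = (\<Sum>i\<le>l. if i = j then e j * L j (B j) else 0)"
        by (intro sum.cong) auto
      then show ?thesis using e0[of j] True L_B_diag[of j] by simp
    next
      case False
      then show ?thesis using c d by (simp add: typeI_spec_def e_def)
    qed
  qed
  then show ?thesis by (auto simp: e_def)
qed

definition typeI :: "nat \<Rightarrow> nat \<Rightarrow> real" where
  "typeI l = (THE c. typeI_spec l c)"

lemma typeI_spec_typeI: "typeI_spec l (typeI l)"
  unfolding typeI_def using typeI_spec_ex typeI_spec_unique by (metis theI)

text \<open>By \<open>dual_B\<close> and \<open>B_expansion\<close> this is the coordinate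
  functional belonging to \<open>B l\<close>; in the concrete setting it is integration against
  Q^(l).\<close>

definition dual :: "nat \<Rightarrow> real poly \<Rightarrow> real" where
  "dual l = comb l (typeI l)"

lemma dual_smult: "dual l (smult a f) = a * dual l f"
  and dual_sum: "dual l (sum h I) = (\<Sum>i\<in>I. dual l (h i))"
  and dual_B: "dual l (B k) = (if k = l then 1 else 0)"
  by (simp_all add: dual_def comb_smult comb_sum comb_B[OF typeI_spec_typeI])

lemma B_expansion:
  assumes "degree f \<le> n" shows "f = (\<Sum>k\<le>n. smult (dual k f) (B k))"
proof -
  obtain c where c: "f = (\<Sum>k\<le>n. smult (c k) (B k))" using B_span[OF assms] by blast
  have "dual i f = c i" if "i \<le> n" for i
    unfolding c using that by (simp add: dual_sum dual_smult dual_B if_distrib[of "\<lambda>x. _ * x"] cong: if_cong)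
  then show ?thesis by (subst c) (intro sum.cong, auto)
qed

lemma dual_eq_0: "degree f < k \<Longrightarrow> dual k f = 0"
  using arg_cong[OF B_expansion[of f "degree f"], of "dual k"]
  by (simp add: dual_sum dual_smult dual_B)

section \<open>The Jacobi matrix and its powers\<close>

lemma Jacobi_B: "Jacobi B n m = dual m ([:0, 1:] * B n)"
proof -
  let ?f = "[:0, 1:] * B n"
  have "Jacobi B n = (\<lambda>m. dual m ?f)"
    unfolding Jacobi_def
  proof (rule the_equality)
    have sub: "{m. dual m ?f \<noteq> 0} \<subseteq> {..degree ?f}" using dual_eq_0[of ?f] by (force simp: not_less[symmetric])
    have "?f = (\<Sum>m\<in>{m. dual m ?f \<noteq> 0}. smult (dual m ?f) (B m))"
    proof -
      have "?f = (\<Sum>m\<le>degree ?f. smult (dual m ?f) (B m))" by (rule B_expansion) simp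
      also have "\<dots> = (\<Sum>m\<in>{m. dual m ?f \<noteq> 0}. smult (dual m ?f) (B m))"
        using sub by (intro sum.mono_neutral_right) auto
      finally show ?thesis .
    qed
    then show "finite {m. dual m ?f \<noteq> 0} \<and> ?f = (\<Sum>m | dual m ?f \<noteq> 0. smult (dual m ?f) (B m))"
      using sub finite_subset by blast
  next
    fix c assume c: "finite {m. c m \<noteq> 0} \<and> ?f = (\<Sum>m | c m \<noteq> 0. smult (c m) (B m))"
    \<comment> \<open>Applying \<open>dual m\<close> to any finite expansion extracts its
      coefficient at \<open>B m\<close>, which gives uniqueness in the definite description.\<close>
    have "dual m ?f = c m" for m
    proof -
      have "dual m ?f = dual m (\<Sum>k | c k \<noteq> 0. smult (c k) (B k))" using c by simp
      also have "\<dots> = (\<Sum>k | c k \<noteq> 0. if k = m then c m else 0)"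
        unfolding dual_sum dual_smult dual_B by (intro sum.cong) auto
      also have "\<dots> = c m" using c by simp
      finally show ?thesis .
    qed
    then show "c = (\<lambda>m. dual m ?f)" by auto
  qed
  then show ?thesis by simp
qed

text \<open>The entry of J^r at (n, m), introduced as the matrix of multiplication by x^r in the
  basis \<open>B\<close>, so that it is an integral from the start; the recursions below identify it
  with the matrix power.\<close>

definition J_pow :: "nat \<Rightarrow> nat \<Rightarrow> nat \<Rightarrow> real" where
  "J_pow r n m = dual m (monom 1 r * B n)"

lemma J_pow_0: "J_pow 0 n m = (if n = m then 1 else 0)"
  by (simp add: J_pow_def dual_B)

lemma B_nonzero: "B n \<noteq> 0"
  using coeff_B[of n] by auto

lemma degree_x_B: "degree ([:0, 1:] * B n) = Suc n"
  using B_nonzero[of n] degree_B[of n] by (simp add: degree_mult_eq)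

lemma degree_monom_B: "degree (monom 1 r * B n) = r + n"
  using B_nonzero[of n] degree_B[of n] by (simp add: degree_mult_eq degree_monom_eq)

lemma Jacobi_B_eq_0: "Suc n < m \<Longrightarrow> Jacobi B n m = 0"
  using degree_x_B[of n] by (simp add: Jacobi_B dual_eq_0)

lemma J_pow_eq_0: "r + n < m \<Longrightarrow> J_pow r n m = 0"
  using degree_monom_B[of r n] by (simp add: J_pow_def dual_eq_0)

lemma x_B_expansion: "[:0, 1:] * B n = (\<Sum>k\<le>Suc n. smult (Jacobi B n k) (B k))"
  unfolding Jacobi_B using degree_x_B[of n] by (intro B_expansion) auto

lemma monom_Suc_eq: "monom (1::real) (Suc r) = monom 1 r * [:0, 1:]"
  by (simp add: monom_Suc)

lemma J_pow_Suc_left: "J_pow (Suc r) n m = (\<Sum>k\<le>Suc n. Jacobi B n k * J_pow r k m)"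
proof -
  have "monom 1 (Suc r) * B n = (\<Sum>k\<le>Suc n. smult (Jacobi B n k) (monom 1 r * B k))"
    by (simp only: monom_Suc_eq mult.assoc x_B_expansion sum_distrib_left mult_smult_right)
  then show ?thesis by (simp only: J_pow_def dual_sum dual_smult)
qed

text \<open>The recursion for the transposed chain: prepending a factor to a power of the transpose
  of J appends one to the power of J.\<close>

lemma J_pow_Suc_right: "J_pow (Suc r) n m = (\<Sum>k\<le>r + n. J_pow r n k * Jacobi B k m)"
proof -
  have "monom 1 r * B n = (\<Sum>k\<le>r + n. smult (J_pow r n k) (B k))"
    unfolding J_pow_def using degree_monom_B[of r n] by (intro B_expansion) auto
  then have "[:0, 1:] * (monom 1 r * B n) = (\<Sum>k\<le>r + n. smult (J_pow r n k) ([:0, 1:] * B k))"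
    by (simp only: sum_distrib_left mult_smult_right)
  moreover have "monom 1 (Suc r) * B n = [:0, 1:] * (monom 1 r * B n)"
    by (simp only: monom_Suc_eq mult_ac)
  ultimately show ?thesis by (simp only: J_pow_def dual_sum dual_smult Jacobi_B)
qed

section \<open>The conjugated matrices: powers and row sums\<close>

lemma imat_pow_P_II:
  assumes "\<And>n. poly (B n) lam \<noteq> 0"
  shows "imat_pow (P_II B lam) r n m
    = poly (B m) lam / poly (B n) lam * (J_pow r n m / lam ^ r)"
proof (induction r arbitrary: n)
  case 0
  then show ?case using assms[of n] by (cases "n = m") (simp_all add: J_pow_0)
next
  case (Suc r)
  have "imat_pow (P_II B lam) (Suc r) n m = (\<Sum>k. poly (B m) lam / poly (B n) lam *
      (Jacobi B n k * J_pow r k m / lam ^ Suc r))"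
    unfolding imat_pow.simps(2)
  proof (intro arg_cong[of _ _ suminf] ext)
    fix k show "P_II B lam n k * imat_pow (P_II B lam) r k m
      = poly (B m) lam / poly (B n) lam * (Jacobi B n k * J_pow r k m / lam ^ Suc r)"
      unfolding Suc unfolding P_II_def scaled_conj_def using assms[of k] by (simp add: field_simps)
  qed
  also have "\<dots> = (\<Sum>k\<le>Suc n. poly (B m) lam / poly (B n) lam *
      (Jacobi B n k * J_pow r k m / lam ^ Suc r))"
    by (rule suminf_finite) (auto simp: Jacobi_B_eq_0 not_le)
  also have "\<dots> = poly (B m) lam / poly (B n) lam * (J_pow (Suc r) n m / lam ^ Suc r)"
    unfolding J_pow_Suc_left by (simp only: sum_distrib_left sum_divide_distrib)
  finally show ?case .
qed

lemma imat_pow_P_I: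
  assumes "\<And>n. Q n lam \<noteq> 0"
  shows "imat_pow (P_I B Q lam) r n m = Q m lam / Q n lam * (J_pow r m n / lam ^ r)"
proof (induction r arbitrary: n)
  case 0
  then show ?case using assms[of n] by (cases "n = m") (simp_all add: J_pow_0)
next
  case (Suc r)
  have "imat_pow (P_I B Q lam) (Suc r) n m = (\<Sum>k. Q m lam / Q n lam *
      (J_pow r m k * Jacobi B k n / lam ^ Suc r))"
    unfolding imat_pow.simps(2)
  proof (intro arg_cong[of _ _ suminf] ext)
    fix k show "P_I B Q lam n k * imat_pow (P_I B Q lam) r k m
      = Q m lam / Q n lam * (J_pow r m k * Jacobi B k n / lam ^ Suc r)"
      unfolding Suc unfolding P_I_def scaled_conj_def using assms[of k] by (simp add: field_simps)
  qed
  \<comment> \<open>Finiteness comes here from the power, not from the row of the transposed matrix: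
    x^r B^(m) has degree r + m.\<close>
  also have "\<dots> = (\<Sum>k\<le>r + m. Q m lam / Q n lam * (J_pow r m k * Jacobi B k n / lam ^ Suc r))"
    by (rule suminf_finite) (auto simp: J_pow_eq_0 not_le)
  also have "\<dots> = Q m lam / Q n lam * (J_pow (Suc r) m n / lam ^ Suc r)"
    unfolding J_pow_Suc_right by (simp only: sum_distrib_left sum_divide_distrib)
  finally show ?case .
qed

text \<open>Evaluating the expansion of x B^(n) at lam shows that the vector of the B^(k)(lam) is an
  eigenvector of J with eigenvalue lam, so the rows sum to 1.\<close>

lemma stochastic_P_II:
  assumes "\<And>n m. 0 \<le> Jacobi B n m" "0 < lam" and pos: "\<And>n. 0 < poly (B n) lam"
  shows "stochastic (P_II B lam)"
  unfolding stochastic_def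
proof (intro conjI allI)
  fix n m show "0 \<le> P_II B lam n m"
    unfolding P_II_def scaled_conj_def using assms(1)[of n m] assms(2) pos[of n] pos[of m] by simp
next
  fix n
  have "(\<Sum>k\<le>Suc n. P_II B lam n k)
      = (\<Sum>k\<le>Suc n. Jacobi B n k * poly (B k) lam) / (lam * poly (B n) lam)"
    unfolding P_II_def scaled_conj_def sum_divide_distrib
    by (intro sum.cong) (auto simp: field_simps)
  also have "(\<Sum>k\<le>Suc n. Jacobi B n k * poly (B k) lam) = poly ([:0, 1:] * B n) lam"
    unfolding x_B_expansion by (simp only: poly_sum poly_smult)
  also have "\<dots> / (lam * poly (B n) lam) = 1" using assms(2) pos[of n] by simp
  finally show "P_II B lam n sums 1"
    using sums_finite[of "{..Suc n}" "P_II B lam n"]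
    by (auto simp: Jacobi_B_eq_0 not_le P_II_def scaled_conj_def)
qed

text \<open>On \<open>\<xi>\<^sup>j\<close> only the first \<open>j + 1\<close> terms of the expansion of \<open>x\<^sup>r\<close> survive, so a bound on
  the entries of \<open>J\<^sup>r\<close> bounds the moments.\<close>

lemma moment_bound:
  assumes "\<And>r k. \<bar>J_pow r 0 k\<bar> \<le> C k * lam ^ r"
  shows "\<bar>L j (monom 1 r)\<bar> \<le> (\<Sum>k\<le>j. C k * \<bar>L j (B k)\<bar>) * lam ^ r"
proof -
  have B0: "B 0 = 1" using degree_B[of 0] coeff_B[of 0]
    by (metis degree_eq_zeroE coeff_pCons_0 one_pCons)
  have "monom 1 r = (\<Sum>k\<le>r + j. smult (J_pow r 0 k) (B k))"
    unfolding J_pow_def B0 mult_1_right by (intro B_expansion) (simp add: degree_monom_eq)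
  then have "L j (monom 1 r) = (\<Sum>k\<le>r + j. J_pow r 0 k * L j (B k))"
    by (simp only: L_sum L_smult)
  also have "\<dots> = (\<Sum>k\<le>j. J_pow r 0 k * L j (B k))"
    by (intro sum.mono_neutral_right) (auto simp: L_B_less)
  also have "\<bar>\<dots>\<bar> \<le> (\<Sum>k\<le>j. \<bar>J_pow r 0 k * L j (B k)\<bar>)" by (rule sum_abs)
  also have "\<dots> \<le> (\<Sum>k\<le>j. C k * lam ^ r * \<bar>L j (B k)\<bar>)"
    unfolding abs_mult using assms by (intro sum_mono mult_right_mono) auto
  also have "\<dots> = (\<Sum>k\<le>j. C k * \<bar>L j (B k)\<bar>) * lam ^ r"
    by (simp add: sum_distrib_right sum_distrib_left mult_ac)
  finally show ?thesis .
qed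

end

subsection \<open>First passage decompositions\<close>

lemma imat_pow_bounds:
  assumes "stochastic P"
  shows "0 \<le> imat_pow P r n m" "imat_pow P r n m \<le> 1"
proof -
  have P: "\<And>n m. 0 \<le> P n m" "\<And>n. P n sums 1" using assms by (auto simp: stochastic_def)
  have "0 \<le> imat_pow P r n m \<and> imat_pow P r n m \<le> 1"
  proof (induction r arbitrary: n)
    case 0 show ?case by simp
  next
    case (Suc r)
    have le: "P n k * imat_pow P r k m \<le> P n k" for k
      using Suc[of k] P(1)[of n k] by (simp add: mult_left_le)
    have s: "summable (\<lambda>k. P n k * imat_pow P r k m)"
    proof (rule summable_comparison_test'[OF sums_summable[OF P(2)[of n]], of 0])
      fix k show "norm (P n k * imat_pow P r k m) \<le> P n k"
        using le[of k] Suc[of k] P(1)[of n k] by simp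
    qed
    have "0 \<le> (\<Sum>k. P n k * imat_pow P r k m)"
      using Suc P(1) by (intro suminf_nonneg[OF s] mult_nonneg_nonneg) auto
    moreover have "(\<Sum>k. P n k * imat_pow P r k m) \<le> 1"
      using suminf_le[OF le s sums_summable[OF P(2)]] sums_unique[OF P(2)[of n]] by simp
    ultimately show ?case by simp
  qed
  then show "0 \<le> imat_pow P r n m" "imat_pow P r n m \<le> 1" by auto
qed

text \<open>The index is shifted by one: the value at \<open>r\<close> belongs to f^(r+1), by
  decomposition according to the first step.\<close>

fun taboo_first :: "(nat \<Rightarrow> nat \<Rightarrow> real) \<Rightarrow> nat \<Rightarrow> nat \<Rightarrow> nat \<Rightarrow> real" where
  "taboo_first P 0 n m = P n m"
| "taboo_first P (Suc r) n m = (\<Sum>k. if k = m then 0 else P n k * taboo_first P r k m)"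

lemma taboo_first_bounds:
  assumes "stochastic P"
  shows "0 \<le> taboo_first P r n m" "taboo_first P r n m \<le> 1"
    and "summable (\<lambda>k. if k = m then 0 else P n k * taboo_first P r k m)"
proof -
  have P: "\<And>n m. 0 \<le> P n m" "\<And>n. P n sums 1" using assms by (auto simp: stochastic_def)
  have step: "summable (\<lambda>k. if k = m then 0 else P n k * taboo_first P r k m)
      \<and> 0 \<le> taboo_first P (Suc r) n m \<and> taboo_first P (Suc r) n m \<le> 1"
    if "\<And>n. 0 \<le> taboo_first P r n m \<and> taboo_first P r n m \<le> 1" for r n
  proof -
    have le: "(if k = m then 0 else P n k * taboo_first P r k m) \<le> P n k" for k
      using that[of k] P(1)[of n k] by (auto simp: mult_left_le)
    have s: "summable (\<lambda>k. if k = m then 0 else P n k * taboo_first P r k m)"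
    proof (rule summable_comparison_test'[OF sums_summable[OF P(2)[of n]], of 0])
      fix k show "norm (if k = m then 0 else P n k * taboo_first P r k m) \<le> P n k"
        using le[of k] that[of k] P(1)[of n k] by (cases "k = m") simp_all
    qed
    have "0 \<le> (\<Sum>k. if k = m then 0 else P n k * taboo_first P r k m)"
      using that P(1) by (intro suminf_nonneg[OF s]) (simp add: mult_nonneg_nonneg)
    moreover have "(\<Sum>k. if k = m then 0 else P n k * taboo_first P r k m) \<le> 1"
      using suminf_le[OF le s sums_summable[OF P(2)]] sums_unique[OF P(2)[of n]] by simp
    ultimately show ?thesis using s by simp
  qed
  have b: "0 \<le> taboo_first P r n m \<and> taboo_first P r n m \<le> 1" for r n
  proof (induction r arbitrary: n)
    case 0
    have "(\<Sum>k\<in>{m}. P n k) \<le> suminf (P n)"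
      using P(1) by (intro sum_le_suminf[OF sums_summable[OF P(2)]]) auto
    then show ?case using P(1)[of n m] sums_unique[OF P(2)[of n]] by simp
  next
    case (Suc r)
    then show ?case using step by blast
  qed
  then show "0 \<le> taboo_first P r n m" "taboo_first P r n m \<le> 1" by auto
  show "summable (\<lambda>k. if k = m then 0 else P n k * taboo_first P r k m)"
    using step b by blast
qed

text \<open>Splitting at the first visit to m, which happens at time k + 1. In the induction the
  first step either hits m, giving the term k = 0, or leads to another state, to which the
  hypothesis applies.\<close>

lemma imat_pow_first_passage_decomposition:
  assumes st: "stochastic P"
  shows "imat_pow P (Suc r) n m = (\<Sum>k\<le>r. taboo_first P k n m * imat_pow P (r - k) m m)"
proof (induction r arbitrary: n)
  case 0
  have "(\<Sum>k. P n k * imat_pow P 0 k m) = (\<Sum>k\<in>{m}. P n k * imat_pow P 0 k m)"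
    by (rule suminf_finite) auto
  then show ?case by simp
next
  case (Suc r)
  have P: "\<And>n m. 0 \<le> P n m" "\<And>n. P n sums 1" using st by (auto simp: stochastic_def)
  have "P n j * imat_pow P (Suc r) j m = (if j = m then P n m * imat_pow P (Suc r) m m else 0)
     + (\<Sum>k\<le>r. (if j = m then 0 else P n j * taboo_first P k j m) * imat_pow P (r - k) m m)" for j
    using Suc.IH[of j] by (cases "j = m") (simp_all add: sum_distrib_left mult.assoc del: imat_pow.simps)
  then have "imat_pow P (Suc (Suc r)) n m = (\<Sum>j. (if j = m then P n m * imat_pow P (Suc r) m m else 0)
     + (\<Sum>k\<le>r. (if j = m then 0 else P n j * taboo_first P k j m) * imat_pow P (r - k) m m))"
    by (subst imat_pow.simps(2)) (rule suminf_cong)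
  also have "\<dots> = P n m * imat_pow P (Suc r) m m
     + (\<Sum>k\<le>r. taboo_first P (Suc k) n m * imat_pow P (r - k) m m)"
  proof (intro sums_unique[symmetric] sums_add sums_sum)
    show "(\<lambda>j. if j = m then P n m * imat_pow P (Suc r) m m else 0) sums (P n m * imat_pow P (Suc r) m m)"
      using sums_single[of m "\<lambda>j. P n m * imat_pow P (Suc r) m m"] by simp
    show "(\<lambda>j. (if j = m then 0 else P n j * taboo_first P k j m) * imat_pow P (r - k) m m) sums
        (taboo_first P (Suc k) n m * imat_pow P (r - k) m m)" for k
      using taboo_first_bounds(3)[OF st, of m n k] by (auto intro!: sums_mult2 summable_sums)
  qed
  also have "\<dots> = (\<Sum>k\<le>Suc r. taboo_first P k n m * imat_pow P (Suc r - k) m m)"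
    by (subst sum.atMost_Suc_shift) simp
  finally show ?case .
qed

section \<open>Generating functions and the renewal equation\<close>

definition taboo_gf :: "(nat \<Rightarrow> nat \<Rightarrow> real) \<Rightarrow> nat \<Rightarrow> nat \<Rightarrow> complex \<Rightarrow> complex" where
  "taboo_gf P n m s = (\<Sum>r. complex_of_real (taboo_first P r n m) * s ^ Suc r)"

lemma summable_norm_bounded_coeff:
  fixes a :: "nat \<Rightarrow> real"
  assumes "cmod s < 1" "\<And>r. \<bar>a r\<bar> \<le> 1"
  shows "summable (\<lambda>r. norm (complex_of_real (a r) * s ^ r))"
proof (rule summable_comparison_test'[of "\<lambda>r. cmod s ^ r" 0])
  show "summable (\<lambda>r. cmod s ^ r)" using assms by simp
  show "norm (norm (complex_of_real (a r) * s ^ r)) \<le> cmod s ^ r" for r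
    using assms(2)[of r] by (simp add: norm_mult norm_power mult_left_le_one_le)
qed

text \<open>The first passage decomposition is a convolution, hence a Cauchy product; for |s| < 1
  both series converge absolutely, as their coefficients lie in [0, 1].\<close>

lemma transition_gf_renewal:
  assumes st: "stochastic P" and s: "cmod s < 1"
  shows "transition_gf P n m s
    = (if n = m then 1 else 0) + taboo_gf P n m s * transition_gf P m m s"
proof -
  let ?f = "\<lambda>r. complex_of_real (taboo_first P r n m) * s ^ r"
  let ?u = "\<lambda>n r. complex_of_real (imat_pow P r n m) * s ^ r"
  have f: "summable (\<lambda>r. norm (?f r))" and u: "summable (\<lambda>r. norm (?u k r))" for k
    using taboo_first_bounds[OF st] imat_pow_bounds[OF st]
    by (intro summable_norm_bounded_coeff[OF s]; simp add: abs_le_iff order_trans[of _ 0 "1::real"])+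
  have "(\<Sum>r. ?f r) * (\<Sum>r. ?u m r) = (\<Sum>r. \<Sum>i\<le>r. ?f i * ?u m (r - i))"
    by (rule Cauchy_product[OF f u])
  also have "(\<lambda>r. \<Sum>i\<le>r. ?f i * ?u m (r - i))
      = (\<lambda>r. complex_of_real (imat_pow P (Suc r) n m) * s ^ r)"
  proof
    fix r
    have "?f i * ?u m (r - i)
        = complex_of_real (taboo_first P i n m * imat_pow P (r - i) m m) * s ^ r" if "i \<le> r" for i
      using that power_add[of s i "r - i"] by simp
    then have "(\<Sum>i\<le>r. ?f i * ?u m (r - i)) = (\<Sum>i\<le>r.
        complex_of_real (taboo_first P i n m * imat_pow P (r - i) m m) * s ^ r)"
      by (intro sum.cong) auto
    then show "(\<Sum>i\<le>r. ?f i * ?u m (r - i)) = complex_of_real (imat_pow P (Suc r) n m) * s ^ r"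
      unfolding imat_pow_first_passage_decomposition[OF st] of_real_sum sum_distrib_right .
  qed
  finally have prod: "(\<Sum>r. ?f r) * (\<Sum>r. ?u m r)
      = (\<Sum>r. complex_of_real (imat_pow P (Suc r) n m) * s ^ r)" .
  have "taboo_gf P n m s = s * (\<Sum>r. ?f r)"
    unfolding taboo_gf_def using suminf_mult[OF summable_norm_cancel[OF f], of s]
    by (simp add: mult_ac)
  moreover have "(\<Sum>r. ?u n (Suc r)) = s * (\<Sum>r. complex_of_real (imat_pow P (Suc r) n m) * s ^ r)"
  proof -
    have "summable (\<lambda>r. complex_of_real (imat_pow P (Suc r) n m) * s ^ r)"
      using imat_pow_bounds[OF st, of "Suc _" n m]
      by (intro summable_norm_cancel[OF summable_norm_bounded_coeff[OF s]])
        (simp add: abs_le_iff order_trans[of _ 0 "1::real"] del: imat_pow.simps)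
    from suminf_mult[OF this, of s] show ?thesis by (simp add: mult_ac del: imat_pow.simps)
  qed
  moreover have "transition_gf P n m s = ?u n 0 + (\<Sum>r. ?u n (Suc r))"
    unfolding transition_gf_def using suminf_split_head[OF summable_norm_cancel[OF u[of n]]] by simp
  moreover have "transition_gf P m m s = (\<Sum>r. ?u m r)" by (simp add: transition_gf_def)
  ultimately show ?thesis using prod by (simp add: mult.assoc del: imat_pow.simps(2))
qed

text \<open>If the value were 0, the renewal equation with n = m would read 0 = 1.\<close>

lemma transition_gf_diag_nonzero:
  assumes "stochastic P" "cmod s < 1" shows "transition_gf P m m s \<noteq> 0"
  using transition_gf_renewal[OF assms, of m m] by auto

lemma taboo_gf_eq:
  assumes "stochastic P" "cmod s < 1"
  shows "taboo_gf P n m s = (if n \<noteq> m then transition_gf P n m s / transition_gf P m m s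
    else 1 - 1 / transition_gf P n n s)"
  using transition_gf_renewal[OF assms, of n m] transition_gf_diag_nonzero[OF assms, of m]
  by (auto simp: field_simps)

section \<open>The Markov property along trajectories\<close>

locale chain = prob_space \<Omega> for \<Omega> :: "'a measure" +
  fixes X :: "nat \<Rightarrow> 'a \<Rightarrow> nat" and P :: "nat \<Rightarrow> nat \<Rightarrow> real"
  assumes markov: "markov_chain \<Omega> X P" and stochastic: "stochastic P"
begin

lemma X_measurable [measurable]: "X k \<in> measurable \<Omega> (count_space UNIV)"
  using markov by (auto simp: markov_chain_def)

text \<open>Coding the path as a list puts its values in a countable type, so events can be split
  over all paths.\<close>

definition traj :: "nat \<Rightarrow> 'a \<Rightarrow> nat list" where
  "traj k \<omega> = map (\<lambda>l. X l \<omega>) [0..<Suc k]"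

text \<open>Expresses that \<open>H\<close> is determined by the variables up to time k, with
  measurability left as a consequence (\<open>past_sets\<close>).\<close>

definition past :: "nat \<Rightarrow> ('a \<Rightarrow> bool) \<Rightarrow> bool" where
  "past k H \<longleftrightarrow> (\<forall>\<omega>\<in>space \<Omega>. \<forall>\<omega>'\<in>space \<Omega>. (\<forall>l\<le>k. X l \<omega> = X l \<omega>') \<longrightarrow> H \<omega> = H \<omega>')"

lemma traj_eq_iff: "traj k \<omega> = traj k \<omega>' \<longleftrightarrow> (\<forall>l\<le>k. X l \<omega> = X l \<omega>')"
  by (auto simp: traj_def less_Suc_eq_le simp del: upt_Suc)

lemma traj_step:
  assumes "\<omega>0 \<in> space \<Omega>"
  shows "\<P>(\<omega> in \<Omega>. traj k \<omega> = traj k \<omega>0 \<and> X (Suc k) \<omega> = b)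
    = \<P>(\<omega> in \<Omega>. traj k \<omega> = traj k \<omega>0) * P (X k \<omega>0) b"
\<comment> \<open>\<open>markov_chain\<close> constrains only conditioning on paths of positive
  probability; on null paths both sides vanish.\<close>
proof (cases "\<P>(\<omega> in \<Omega>. traj k \<omega> = traj k \<omega>0) = 0")
  case True
  have "\<P>(\<omega> in \<Omega>. traj k \<omega> = traj k \<omega>0 \<and> X (Suc k) \<omega> = b) \<le> \<P>(\<omega> in \<Omega>. traj k \<omega> = traj k \<omega>0)"
    unfolding traj_eq_iff by (intro finite_measure_mono) auto
  then show ?thesis using True by (simp add: measure_le_0_iff)
next
  case False
  then have pos: "0 < \<P>(\<omega> in \<Omega>. traj k \<omega> = traj k \<omega>0)" by (simp add: zero_less_measure_iff)
  have "\<P>(\<omega> in \<Omega>. X (Suc k) \<omega> = b \<bar> \<forall>l\<le>k. X l \<omega> = X l \<omega>0) = P (X k \<omega>0) b"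
    using markov[unfolded markov_chain_def, THEN conjunct2, THEN conjunct2,
        rule_format, of k "\<lambda>l. X l \<omega>0" b] pos
    unfolding traj_eq_iff by simp
  then show ?thesis using pos unfolding cond_prob_def traj_eq_iff
    by (simp add: field_simps conj_commute)
qed

lemma past_sets:
  assumes "past k H" shows "{\<omega>\<in>space \<Omega>. H \<omega>} \<in> sets \<Omega>"
proof -
  let ?I = "traj k ` {\<omega>\<in>space \<Omega>. H \<omega>}"
  have "{\<omega>\<in>space \<Omega>. H \<omega>} = (\<Union>ys\<in>?I. {\<omega>\<in>space \<Omega>. traj k \<omega> = ys})"
    using assms by (auto simp: past_def traj_eq_iff) 
  also have "\<dots> \<in> sets \<Omega>"
    by (intro sets.countable_UN') (auto simp: traj_eq_iff)
  finally show ?thesis .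
qed

text \<open>\<open>traj_step\<close> summed over the countably many paths that make up the event.
  The sum is taken in extended nonnegative reals, where the constant factor can be pulled out
  freely.\<close>

lemma past_step:
  assumes H: "past k H"
  shows "\<P>(\<omega> in \<Omega>. H \<omega> \<and> X k \<omega> = a \<and> X (Suc k) \<omega> = b) = \<P>(\<omega> in \<Omega>. H \<omega> \<and> X k \<omega> = a) * P a b"
proof -
  let ?I = "traj k ` {\<omega>\<in>space \<Omega>. H \<omega> \<and> X k \<omega> = a}"
  let ?E = "\<lambda>ys. {\<omega>\<in>space \<Omega>. traj k \<omega> = ys}"
  let ?F = "\<lambda>ys. {\<omega>\<in>space \<Omega>. traj k \<omega> = ys \<and> X (Suc k) \<omega> = b}"
  have c: "countable ?I" by simp
  have F_eq_E: "emeasure \<Omega> (?F ys) = emeasure \<Omega> (?E ys) * ennreal (P a b)" if ys: "ys \<in> ?I" for ys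
  proof -
    obtain \<omega>0 where o: "\<omega>0 \<in> space \<Omega>" "X k \<omega>0 = a" "ys = traj k \<omega>0" using ys by blast
    show ?thesis using traj_step[OF o(1), of k b] o
      by (simp add: emeasure_eq_measure ennreal_mult')
  qed
  have "emeasure \<Omega> (\<Union>ys\<in>?I. ?F ys) = (\<integral>\<^sup>+ys. emeasure \<Omega> (?F ys) \<partial>count_space ?I)"
    using c by (intro emeasure_UN_countable) (auto simp: disjoint_family_on_def traj_eq_iff)
  also have "\<dots> = (\<integral>\<^sup>+ys. emeasure \<Omega> (?E ys) * ennreal (P a b) \<partial>count_space ?I)"
    by (intro nn_integral_cong) (simp add: F_eq_E)
  also have "\<dots> = (\<integral>\<^sup>+ys. emeasure \<Omega> (?E ys) \<partial>count_space ?I) * ennreal (P a b)"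
    by (intro nn_integral_multc) auto
  also have "(\<integral>\<^sup>+ys. emeasure \<Omega> (?E ys) \<partial>count_space ?I) = emeasure \<Omega> (\<Union>ys\<in>?I. ?E ys)"
    using c by (intro emeasure_UN_countable[symmetric]) (auto simp: disjoint_family_on_def traj_eq_iff)
  also have "(\<Union>ys\<in>?I. ?E ys) = {\<omega>\<in>space \<Omega>. H \<omega> \<and> X k \<omega> = a}"
    using H by (auto simp: past_def traj_eq_iff)
  also have "(\<Union>ys\<in>?I. ?F ys) = {\<omega>\<in>space \<Omega>. H \<omega> \<and> X k \<omega> = a \<and> X (Suc k) \<omega> = b}"
    using H by (auto simp: past_def traj_eq_iff)
  finally have e: "emeasure \<Omega> {\<omega>\<in>space \<Omega>. H \<omega> \<and> X k \<omega> = a \<and> X (Suc k) \<omega> = b}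
      = emeasure \<Omega> {\<omega>\<in>space \<Omega>. H \<omega> \<and> X k \<omega> = a} * ennreal (P a b)" .
  show ?thesis
    using arg_cong[OF e, of enn2real] stochastic
    unfolding enn2real_mult measure_def stochastic_def by auto
qed

text \<open>The arbitrary past event and starting time make the induction work: after one step the
  condition at time k is absorbed into the past of time k + 1, and the event is split by the value
  of the chain there.\<close>

lemma past_first_passage:
  assumes "past k H"
  shows "\<P>(\<omega> in \<Omega>. H \<omega> \<and> X k \<omega> = a \<and> (\<forall>l\<in>{1..r}. X (k + l) \<omega> \<noteq> m) \<and> X (k + Suc r) \<omega> = m)
    = \<P>(\<omega> in \<Omega>. H \<omega> \<and> X k \<omega> = a) * taboo_first P r a m"
  using assms
proof (induction r arbitrary: k H a)
  case 0
  then show ?case using past_step[OF 0, of a m] by simp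
next
  case (Suc r)
  have Hm [measurable]: "Measurable.pred \<Omega> H" using past_sets[OF Suc.prems] by (simp add: pred_def)
  let ?H = "\<lambda>\<omega>. H \<omega> \<and> X k \<omega> = a"
  have past: "past (Suc k) ?H" using Suc.prems unfolding past_def by (metis le_Suc_eq order_refl)
  let ?S = "\<lambda>c. {\<omega>\<in>space \<Omega>. c \<noteq> m \<and> ?H \<omega> \<and> X (Suc k) \<omega> = c \<and>
      (\<forall>l\<in>{1..r}. X (Suc k + l) \<omega> \<noteq> m) \<and> X (Suc k + Suc r) \<omega> = m}"
  have split: "(\<forall>l\<in>{1..Suc r}. X (k + l) \<omega> \<noteq> m) \<longleftrightarrow>
      X (Suc k) \<omega> \<noteq> m \<and> (\<forall>l\<in>{1..r}. X (Suc k + l) \<omega> \<noteq> m)" for \<omega>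
  proof -
    have "{1..Suc r} = insert 1 (Suc ` {1..r})"
      unfolding image_Suc_atLeastAtMost by (rule atLeastAtMost_insertL[symmetric]) simp
    then have "(\<forall>l\<in>{1..Suc r}. X (k + l) \<omega> \<noteq> m)
        \<longleftrightarrow> (\<forall>l\<in>insert 1 (Suc ` {1..r}). X (k + l) \<omega> \<noteq> m)"
      by (rule arg_cong)
    then show ?thesis
      unfolding ball_simps by (simp del: image_Suc_atLeastAtMost)
  qed
  have U: "{\<omega>\<in>space \<Omega>. H \<omega> \<and> X k \<omega> = a \<and> (\<forall>l\<in>{1..Suc r}. X (k + l) \<omega> \<noteq> m) \<and> X (k + Suc (Suc r)) \<omega> = m}
      = (\<Union>c. ?S c)"
    unfolding split by auto
  have S: "measure \<Omega> (?S c) = \<P>(\<omega> in \<Omega>. ?H \<omega>) * (if c = m then 0 else P a c * taboo_first P r c m)" for c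
  proof (cases "c = m")
    case False
    then have "measure \<Omega> (?S c) = \<P>(\<omega> in \<Omega>. ?H \<omega> \<and> X (Suc k) \<omega> = c) * taboo_first P r c m"
      using Suc.IH[OF past, of c] by simp
    also have "\<P>(\<omega> in \<Omega>. ?H \<omega> \<and> X (Suc k) \<omega> = c) = \<P>(\<omega> in \<Omega>. ?H \<omega>) * P a c"
      using past_step[OF Suc.prems, of a c] by simp
    finally show ?thesis using False by simp
  qed simp
  have sums: "(\<lambda>c. measure \<Omega> (?S c)) sums measure \<Omega> (\<Union>c. ?S c)"
    by (intro finite_measure_UNION) (auto simp: disjoint_family_on_def)
  show ?case
  \<comment> \<open>For a positive factor, summability of the taboo series follows from that of the
    measures; for factor 0 both sides are 0.\<close>
  proof (cases "\<P>(\<omega> in \<Omega>. ?H \<omega>) = 0")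
    case True
    then show ?thesis using sums_unique[OF sums] unfolding U S by simp
  next
    case False
    have "summable (\<lambda>c. if c = m then 0 else P a c * taboo_first P r c m)"
      using sums_summable[OF sums] False unfolding S by (simp add: summable_cmult_iff)
    then show ?thesis using sums_unique[OF sums] unfolding U S by (simp add: suminf_mult)
  qed
qed

lemma first_passage_eq:
  assumes "0 < \<P>(\<omega> in \<Omega>. X 0 \<omega> = n)"
  shows "first_passage \<Omega> X (Suc r) n m = taboo_first P r n m"
proof -
  have "past 0 (\<lambda>_. True)" by (simp add: past_def)
  from past_first_passage[OF this, of n r m]
  have "\<P>(\<omega> in \<Omega>. X 0 \<omega> = n \<and> (\<forall>l\<in>{1..r}. X l \<omega> \<noteq> m) \<and> X (Suc r) \<omega> = m)
    = \<P>(\<omega> in \<Omega>. X 0 \<omega> = n) * taboo_first P r n m" by simp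
  moreover have "{1..<Suc r} = {1..r}" by auto
  ultimately show ?thesis using assms
    by (simp add: first_passage_def cond_prob_def conj_ac)
qed

end

lemma first_passage_gf_eq:
  assumes "markov_chain \<Omega> X P" "stochastic P" "0 < \<P>(\<omega> in \<Omega>. X 0 \<omega> = n)" "cmod s < 1"
  shows "first_passage_gf \<Omega> X n m s = (if n \<noteq> m then transition_gf P n m s / transition_gf P m m s
    else 1 - 1 / transition_gf P n n s)"
proof -
  interpret chain \<Omega> X P
    using assms(1,2) by (auto simp: markov_chain_def chain_def chain_axioms_def)
  show ?thesis
    using taboo_gf_eq[OF assms(2,4)] first_passage_eq[OF assms(3)]
    by (simp add: first_passage_gf_def taboo_gf_def)
qed

subsection \<open>Normality along the step-line\<close>

context
  fixes p :: nat and nv :: "nat \<Rightarrow> nat"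
  assumes p: "1 \<le> p" and nv: "\<forall>a\<in>{1..p}. 1 \<le> nv a"
begin

lemma decomp_unique: "\<exists>!t. is_decomp p nv i t"
  by (rule decomp_ex1[OF p]) (use nv in \<open>simp add: Suc_le_eq\<close>)

lemma decomp_eqI: "is_decomp p nv i t \<Longrightarrow> decomp p nv i = t"
  unfolding decomp_def by (rule the1_equality[OF decomp_unique])

lemma is_decomp_decomp: "is_decomp p nv i (decomp p nv i)"
  unfolding decomp_def by (rule theI'[OF decomp_unique])

lemma idx_a_in: "idx_a p nv i \<in> {1..p}"
  and idx_r_less: "idx_r p nv i < nv (idx_a p nv i)"
  and idx_sum: "i = idx_q p nv i * msize p nv + (\<Sum>b=1..<idx_a p nv i. nv b) + idx_r p nv i"
  using is_decomp_decomp[of i]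
  by (simp_all add: is_decomp_def idx_a_def idx_q_def idx_r_def split_beta)

text \<open>Division of i by n_a with remainder yields q and r, so every x^i w_a occurs among the
  xi^(j).\<close>

lemma idx_ex:
  assumes a: "a \<in> {1..p}" shows "\<exists>j. idx_a p nv j = a \<and> idx_k p nv j = i"
proof -
  have pos: "0 < nv a" using nv a by (auto simp: Suc_le_eq)
  let ?t = "(i div nv a, a, i mod nv a)"
  let ?j = "(i div nv a) * msize p nv + (\<Sum>b=1..<a. nv b) + i mod nv a"
  have "decomp p nv ?j = ?t"
    using a pos by (intro decomp_eqI) (auto simp: is_decomp_def)
  then show ?thesis
    by (intro exI[of _ ?j]) (simp add: idx_k_def idx_a_def idx_q_def idx_r_def)
qed

text \<open>For a fixed weight the order of the indices is the lexicographic order of (q, r),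
  because r < n_a <= |n|, and q n_a + r is increasing in that order.\<close>

lemma idx_k_less:
  assumes "idx_a p nv i = a" "idx_a p nv j = a" "i < j"
  shows "idx_k p nv i < idx_k p nv j"
proof -
  let ?q = "idx_q p nv" and ?r = "idx_r p nv" and ?N = "msize p nv"
  have r: "?r i < nv a" "?r j < nv a" using idx_r_less[of i] idx_r_less[of j] assms by auto
  have "nv a \<le> ?N"
    unfolding msize_def using idx_a_in[of i] assms by (intro member_le_sum) auto
  have lt: "?q i * ?N + ?r i < ?q j * ?N + ?r j"
    using idx_sum[of i] idx_sum[of j] \<open>i < j\<close> unfolding assms(1,2) by linarith
  have "\<not> ?q j < ?q i"
  proof
    assume "?q j < ?q i"
    then have "Suc (?q j) * ?N \<le> ?q i * ?N" by (intro mult_right_mono) auto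
    then show False using lt r \<open>nv a \<le> ?N\<close> by simp
  qed
  then consider "?q i = ?q j" | "Suc (?q i) \<le> ?q j" by linarith
  then show ?thesis
  proof cases
    case 1
    then show ?thesis using lt assms by (simp add: idx_k_def)
  next
    case 2
    then have "Suc (?q i) * nv a \<le> ?q j * nv a" by (intro mult_right_mono) auto
    then show ?thesis using r assms by (simp add: idx_k_def)
  qed
qed

text \<open>The multi-index whose orthogonality conditions are those against xi^(0), ...,
  xi^(l-1).\<close>

definition stepline :: "nat \<Rightarrow> nat \<Rightarrow> nat" where
  "stepline l a = card {j. j < l \<and> idx_a p nv j = a}"

lemma msize_stepline: "msize p (stepline l) = l"
proof -
  have "{..<l} = (\<Union>a\<in>{1..p}. {j. j < l \<and> idx_a p nv j = a})" using idx_a_in by auto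
  then have "card {..<l} = (\<Sum>a=1..p. stepline l a)"
    unfolding stepline_def by (subst card_UN_disjoint[symmetric]) auto
  then show ?thesis by (simp add: msize_def)
qed

text \<open>Pigeonhole: if x^i w_a came only at an index >= l, the indices below l with weight a
  would carry distinct powers below i, so there would be at most i of them.\<close>

lemma stepline_ex:
  assumes "a \<in> {1..p}" "i < stepline l a"
  shows "\<exists>j<l. idx_a p nv j = a \<and> idx_k p nv j = i"
proof -
  obtain j0 where j0: "idx_a p nv j0 = a" "idx_k p nv j0 = i" using idx_ex[OF assms(1)] by blast
  have "j0 < l"
  proof (rule ccontr)
    assume "\<not> j0 < l"
    let ?S = "{j. j < l \<and> idx_a p nv j = a}"
    have "inj_on (idx_k p nv) ?S"
      using idx_k_less by (intro linorder_inj_onI) (auto, metis less_irrefl)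
    moreover have "idx_k p nv ` ?S \<subseteq> {..<i}"
      using idx_k_less[of _ a j0] j0 \<open>\<not> j0 < l\<close> by auto
    ultimately have "card ?S \<le> i" by (metis card_inj_on_le card_lessThan finite_lessThan)
    then show False using assms(2) by (simp add: stepline_def)
  qed
  then show ?thesis using j0 by blast
qed

lemma perfect_stepline:
  assumes "perfect \<epsilon> M p w" "f \<noteq> 0"
    and orth: "\<And>j. j < l \<Longrightarrow> sint \<epsilon> M (\<lambda>x. poly f x * xi p nv w j x) = 0"
  shows "l \<le> degree f"
proof (rule ccontr)
  assume "\<not> l \<le> degree f"
  have "sint \<epsilon> M (\<lambda>x. x ^ i * poly f x * w a x) = 0"
    if ai: "a \<in> {1..p}" "i < stepline l a" for a i
  proof -
    obtain j where j: "j < l" "idx_a p nv j = a" "idx_k p nv j = i"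
      using stepline_ex[OF ai] by blast
    then have "(\<lambda>x. x ^ i * poly f x * w a x) = (\<lambda>x. poly f x * xi p nv w j x)"
      by (auto simp: xi_def)
    then show ?thesis using orth[OF j(1)] by simp
  qed
  moreover have "normal_index \<epsilon> M p w (stepline l)" using assms(1) by (simp add: perfect_def)
  ultimately have "degree f = l"
    using \<open>f \<noteq> 0\<close> \<open>\<not> l \<le> degree f\<close> unfolding normal_index_def msize_stepline by auto
  then show False using \<open>\<not> l \<le> degree f\<close> by simp
qed

end

subsection \<open>Supports and geometric series\<close>

text \<open>Bernoulli's inequality
  \<open>(x / lam)\<^sup>2\<^sup>r \<ge> r ((x / lam)\<^sup>2 - 1)\<close> bounds \<open>r\<close> times a nonnegative integral that is positive
  unless the weight vanishes for \<open>\<bar>x\<bar> > lam\<close>.\<close>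

lemma AE_support_of_moment_bound:
  fixes g :: "real \<Rightarrow> real"
  assumes int: "\<And>k. integrable M (\<lambda>x. x ^ k * g x)"
    and nonneg: "\<And>x. x \<in> space M \<Longrightarrow> 0 \<le> g x"
    and lam: "0 < lam"
    and bound: "\<And>r. (\<integral>x. x ^ r * g x \<partial>M) \<le> C * lam ^ r"
    and id: "(\<lambda>x. x) \<in> borel_measurable M"
  shows "AE x in M. g x \<noteq> 0 \<longrightarrow> \<bar>x\<bar> \<le> lam"
proof -
  note [measurable] = id
  have gm [measurable]: "g \<in> borel_measurable M" using int[of 0] by auto
  \<comment> \<open>On the space, \<open>h\<close> is nonnegative and vanishes exactly where
    \<open>g\<close> does or |x| <= lam; the second moment of \<open>g\<close> dominates it.\<close>
  define h where "h x = max 0 ((x / lam)\<^sup>2 - 1) * g x" for x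
  have h_nonneg: "0 \<le> h x" if "x \<in> space M" for x
    using nonneg[OF that] by (simp add: h_def)
  have int': "integrable M (\<lambda>x. (x / lam) ^ k * g x)" for k
    using integrable_mult_right[OF int[of k], of "1 / lam ^ k"] by (simp add: power_divide)
  have int_h: "integrable M h"
  proof (rule Bochner_Integration.integrable_bound)
    show "integrable M (\<lambda>x. (x / lam) ^ 2 * g x)" by (rule int')
    show "h \<in> borel_measurable M" unfolding h_def by measurable
    show "AE x in M. norm (h x) \<le> norm ((x / lam) ^ 2 * g x)"
      using nonneg by (intro AE_I2) (auto simp: h_def abs_mult intro!: mult_right_mono)
  qed
  have le: "real r * h x \<le> (x / lam) ^ (2 * r) * g x" if "x \<in> space M" for r x
  proof -
    let ?y = "(x / lam)\<^sup>2 - 1"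
    have "real r * max 0 ?y \<le> (1 + ?y) ^ r"
      using Bernoulli_inequality[of ?y r] by (auto simp: max_def)
    then have "real r * max 0 ?y * g x \<le> (1 + ?y) ^ r * g x"
      using nonneg[OF that] by (intro mult_right_mono)
    then show ?thesis by (simp add: h_def power_mult mult.assoc)
  qed
  have "real r * integral\<^sup>L M h \<le> C" for r
  proof -
    have "real r * integral\<^sup>L M h = (\<integral>x. real r * h x \<partial>M)" by simp
    also have "\<dots> \<le> (\<integral>x. (x / lam) ^ (2 * r) * g x \<partial>M)"
      using le int_h int' by (intro integral_mono) auto
    also have "\<dots> = (\<integral>x. x ^ (2 * r) * g x \<partial>M) / lam ^ (2 * r)"
      by (simp add: power_divide)
    also have "\<dots> \<le> C" using bound[of "2 * r"] lam by (simp add: divide_le_eq)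
    finally show ?thesis .
  qed
  \<comment> \<open>The bound by \<open>C\<close> holds for all multiples r, so the integral cannot
    be positive.\<close>
  then have "integral\<^sup>L M h \<le> 0" by (meson reals_Archimedean3 not_le less_imp_le)
  moreover have h_AE: "AE x in M. 0 \<le> h x" using h_nonneg by (rule AE_I2)
  ultimately have "integral\<^sup>L M h = 0" by (intro antisym integral_nonneg_AE)
  then have "AE x in M. h x = 0"
    using integral_nonneg_eq_0_iff_AE[OF int_h h_AE] by simp
  then show ?thesis
  proof (rule AE_mp, intro AE_I2 impI)
    fix x assume "h x = 0" "g x \<noteq> 0"
    then have "(x / lam)\<^sup>2 \<le> 1" by (auto simp: h_def max_def split: if_splits)
    then show "\<bar>x\<bar> \<le> lam" using lam by (simp add: abs_square_le_1)
  qed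
qed

text \<open>Almost everywhere the terms are dominated by |s|^r |f|, which allows summation under the
  integral. Points where the denominator vanishes have |x| > lam, and there \<open>f\<close> is zero
  up to a null set.\<close>

lemma geometric_integral_sums:
  fixes f :: "real \<Rightarrow> real" and s :: complex
  assumes int: "\<And>r. integrable M (\<lambda>x. x ^ r * f x)"
    and lam: "0 < lam" and s: "cmod s < 1"
    and supp: "AE x in M. f x \<noteq> 0 \<longrightarrow> \<bar>x\<bar> \<le> lam"
    and id: "(\<lambda>x. x) \<in> borel_measurable M"
  shows "(\<lambda>r. complex_of_real ((\<integral>x. x ^ r * f x \<partial>M) / lam ^ r) * s ^ r) sums
    (\<integral>x. complex_of_real (f x) / (1 - s / complex_of_real lam * complex_of_real x) \<partial>M)"
proof -
  define t where "t x = s / complex_of_real lam * complex_of_real x" for x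
  have t_le: "norm (t x) \<le> cmod s" if "\<bar>x\<bar> \<le> lam" for x
  proof -
    have "cmod s * (\<bar>x\<bar> / lam) \<le> cmod s * 1"
      using that lam by (intro mult_left_mono) auto
    then show ?thesis using lam by (simp add: t_def norm_mult norm_divide)
  qed
  define F where "F r x = t x ^ r * complex_of_real (f x)" for r x
  have F: "F r = (\<lambda>x. (s / complex_of_real lam) ^ r * complex_of_real (x ^ r * f x))" for r
    by (intro ext) (simp only: F_def t_def power_mult_distrib of_real_mult of_real_power mult.assoc)
  have int_F: "integrable M (F r)" for r
    unfolding F by (intro integrable_mult_right integrable_of_real int)
  have F_le: "AE x in M. \<forall>r. norm (F r x) \<le> cmod s ^ r * \<bar>f x\<bar>"
    using supp
  proof (rule AE_mp, intro AE_I2 impI allI)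
    fix x r assume x: "f x \<noteq> 0 \<longrightarrow> \<bar>x\<bar> \<le> lam"
    show "norm (F r x) \<le> cmod s ^ r * \<bar>f x\<bar>"
    proof (cases "f x = 0")
      case False
      then have "norm (t x) \<le> cmod s" using x t_le by blast
      then show ?thesis by (auto simp: F_def norm_mult norm_power intro!: mult_right_mono power_mono)
    qed (simp add: F_def)
  qed
  have int_f: "integrable M (\<lambda>x. \<bar>f x\<bar>)" using int[of 0] by simp
  have geo: "summable (\<lambda>r. cmod s ^ r)" using s by simp
  have sums: "(\<lambda>r. integral\<^sup>L M (F r)) sums (\<integral>x. (\<Sum>r. F r x) \<partial>M)"
  proof (rule sums_integral[OF int_F])
    show "AE x in M. summable (\<lambda>r. norm (F r x))"
      using F_le
    proof (rule AE_mp, intro AE_I2 impI)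
      fix x assume "\<forall>r. norm (F r x) \<le> cmod s ^ r * \<bar>f x\<bar>"
      then show "summable (\<lambda>r. norm (F r x))"
        by (intro summable_comparison_test'[OF summable_mult2[OF geo, of "\<bar>f x\<bar>"], of 0]) auto
    qed
    show "summable (\<lambda>r. \<integral>x. norm (F r x) \<partial>M)"
    proof (rule summable_comparison_test'[OF summable_mult2[OF geo, of "\<integral>x. \<bar>f x\<bar> \<partial>M"], of 0])
      fix r
      have "(\<integral>x. norm (F r x) \<partial>M) \<le> (\<integral>x. cmod s ^ r * \<bar>f x\<bar> \<partial>M)"
        using F_le int_F int_f by (intro integral_mono_AE) auto
      then show "norm (\<integral>x. norm (F r x) \<partial>M) \<le> cmod s ^ r * (\<integral>x. \<bar>f x\<bar> \<partial>M)" by simp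
    qed
  qed
  have "integral\<^sup>L M (F r) = complex_of_real ((\<integral>x. x ^ r * f x \<partial>M) / lam ^ r) * s ^ r" for r
  proof -
    have "integral\<^sup>L M (F r) = (s / complex_of_real lam) ^ r * complex_of_real (\<integral>x. x ^ r * f x \<partial>M)"
      unfolding F by (simp only: integral_mult_right_zero integral_complex_of_real)
    then show ?thesis by (simp add: power_divide)
  qed
  moreover have "(\<integral>x. (\<Sum>r. F r x) \<partial>M)
      = (\<integral>x. complex_of_real (f x) / (1 - t x) \<partial>M)"
  proof (rule integral_cong_AE)
    show "(\<lambda>x. \<Sum>r. F r x) \<in> borel_measurable M" using int_F by measurable
    have eq: "AE x in M. (\<Sum>r. F r x) = complex_of_real (f x) / (1 - t x)"
      using supp
    proof (rule AE_mp, intro AE_I2 impI)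
      fix x assume x: "f x \<noteq> 0 \<longrightarrow> \<bar>x\<bar> \<le> lam"
      show "(\<Sum>r. F r x) = complex_of_real (f x) / (1 - t x)"
      proof (cases "f x = 0")
        case False
        then have "norm (t x) < 1" using x t_le s by (meson le_less_trans)
        then have "(\<lambda>r. t x ^ r * complex_of_real (f x)) sums (1 / (1 - t x) * complex_of_real (f x))"
          by (intro sums_mult2 geometric_sums)
        then show ?thesis by (simp add: F_def sums_iff)
      qed (simp add: F_def)
    qed
    show "AE x in M. (\<Sum>r. F r x) = complex_of_real (f x) / (1 - t x)" by (rule eq)
    note [measurable] = id
    have [measurable]: "f \<in> borel_measurable M" using int[of 0] by auto
    show "(\<lambda>x. complex_of_real (f x) / (1 - t x)) \<in> borel_measurable M"
      unfolding t_def by measurable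
  qed
  ultimately show ?thesis using sums by (simp add: t_def)
qed

subsection \<open>Multiple orthogonal polynomials\<close>

locale mop_system =
  fixes \<Delta> :: "real set" and \<epsilon> :: real and M :: "real measure"
    and p :: nat and nv :: "nat \<Rightarrow> nat" and w :: "nat \<Rightarrow> real \<Rightarrow> real"
  assumes eps: "\<epsilon> = 1 \<or> \<epsilon> = -1"
    and sets_M: "sets M = sets (restrict_space borel \<Delta>)"
    and p: "1 \<le> p" and nv: "\<forall>a\<in>{1..p}. 1 \<le> nv a"
    and int_w: "\<forall>a\<in>{1..p}. \<forall>k. integrable M (\<lambda>x. x ^ k * w a x)"
    and sign: "\<forall>a\<in>{1..p}. no_sign_change_on \<Delta> (w a)"
    and perf: "perfect \<epsilon> M p w"
begin

abbreviation "\<xi> \<equiv> xi p nv w"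

definition L :: "nat \<Rightarrow> real poly \<Rightarrow> real" where
  "L j f = sint \<epsilon> M (\<lambda>x. poly f x * \<xi> j x)"

lemma space_M: "space M = \<Delta>"
  using sets_eq_imp_space_eq[OF sets_M] by (simp add: space_restrict_space)

lemma id_measurable: "(\<lambda>x. x) \<in> borel_measurable M"
  unfolding measurable_cong_sets[OF sets_M refl] by (intro measurable_restrict_space1) simp

lemma integrable_poly_w:
  assumes "a \<in> {1..p}" shows "integrable M (\<lambda>x. poly f x * w a x)"
proof -
  have "(\<lambda>x. poly f x * w a x) = (\<lambda>x. \<Sum>i\<le>degree f. coeff f i * (x ^ i * w a x))"
    by (auto simp: poly_altdef sum_distrib_right mult.assoc)
  then show ?thesis using int_w assms by simp
qed

lemma integrable_poly_xi: "integrable M (\<lambda>x. poly f x * \<xi> j x)"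
  using integrable_poly_w[OF idx_a_in[OF p nv, of j], of "f * monom 1 (idx_k p nv j)"]
  by (simp add: xi_def poly_monom mult.assoc)

text \<open>Integrability of the moments gives linearity; perfectness, through the step-line
  multi-indices, gives \<open>normal\<close>.\<close>

sublocale normal_functionals L
proof
  show "L j (f + g) = L j f + L j g" for j f g
    using integrable_poly_xi[of f j] integrable_poly_xi[of g j]
    by (simp add: L_def sint_def distrib_right distrib_left)
  show "L j (smult c f) = c * L j f" for j c f
    by (simp add: L_def sint_def mult.assoc)
  show "l \<le> degree f" if "f \<noteq> 0" "\<And>j. j < l \<Longrightarrow> L j f = 0" for f l
    using perfect_stepline[OF p nv perf that(1)] that(2) by (simp add: L_def)
qed

lemma typeII_B_eq: "typeII_B \<epsilon> M p nv w = B"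
  by (simp add: fun_eq_iff typeII_B_def B_def typeII_spec_def L_def)

lemma sint_poly_comb:
  "sint \<epsilon> M (\<lambda>x. poly f x * (\<Sum>j\<le>l. c j * \<xi> j x)) = comb l c f"
proof -
  have "(\<lambda>x. poly f x * (\<Sum>j\<le>l. c j * \<xi> j x)) = (\<lambda>x. \<Sum>j\<le>l. c j * (poly f x * \<xi> j x))"
    by (simp add: sum_distrib_left mult_ac)
  then show ?thesis
    using integrable_poly_xi by (simp add: comb_def L_def sint_def sum_distrib_left mult_ac)
qed

lemma typeI_coeff_eq: "typeI_coeff \<epsilon> M p nv w = typeI"
proof -
  have "sint \<epsilon> M (\<lambda>x. x ^ i * (\<Sum>j\<le>l. c j * \<xi> j x)) = comb l c (monom 1 i)" for i l c
    using sint_poly_comb[where f = "monom 1 i" and l = l and c = c] by (simp add: poly_monom)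
  then show ?thesis
    by (simp add: fun_eq_iff typeI_coeff_def typeI_def typeI_spec_def)
qed

abbreviation "Q \<equiv> typeI_Q \<epsilon> M p nv w"

lemma Q_eq: "Q l x = (\<Sum>j\<le>l. typeI l j * \<xi> j x)"
proof -
  have "Q l x = (\<Sum>a=1..p. \<Sum>j | j \<in> {..l} \<and> idx_a p nv j = a. typeI l j * \<xi> j x)"
    unfolding typeI_Q_def typeI_A_def typeI_coeff_eq poly_sum sum_distrib_right
    by (intro sum.cong) (auto simp: poly_monom xi_def)
  also have "\<dots> = (\<Sum>j\<le>l. typeI l j * \<xi> j x)"
    using idx_a_in[OF p nv] by (intro sum.group) auto
  finally show ?thesis .
qed

lemma dual_eq: "dual l f = sint \<epsilon> M (\<lambda>x. poly f x * Q l x)"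
  unfolding Q_eq dual_def sint_poly_comb ..

lemma integrable_poly_Q: "integrable M (\<lambda>x. poly f x * Q l x)"
proof -
  have "(\<lambda>x. poly f x * Q l x) = (\<lambda>x. \<Sum>j\<le>l. typeI l j * (poly f x * \<xi> j x))"
    by (simp add: Q_eq sum_distrib_left mult_ac)
  then show ?thesis using integrable_poly_xi by simp
qed

lemma J_pow_eq: "J_pow r n m = \<epsilon> * (\<integral>x. x ^ r * (poly (B n) x * Q m x) \<partial>M)"
  by (simp add: J_pow_def dual_eq sint_def poly_monom mult.assoc)

lemma AE_weight_support:
  assumes a: "a \<in> {1..p}" and lam: "0 < lam"
    and bound: "\<And>r k. \<bar>J_pow r 0 k\<bar> \<le> C k * lam ^ r"
  shows "AE x in M. w a x \<noteq> 0 \<longrightarrow> \<bar>x\<bar> \<le> lam"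
proof -
  \<comment> \<open>With this index xi^(j) is w_a itself, so \<open>moment_bound\<close> controls
    the moments of w_a.\<close>
  obtain j where j: "idx_a p nv j = a" "idx_k p nv j = 0" using idx_ex[OF p nv a] by blast
  have L: "L j (monom 1 r) = \<epsilon> * (\<integral>x. x ^ r * w a x \<partial>M)" for r
    using j by (simp add: L_def sint_def xi_def poly_monom)
  obtain \<sigma> :: real where \<sigma>: "\<sigma> = 1 \<or> \<sigma> = -1" "\<And>x. x \<in> \<Delta> \<Longrightarrow> 0 \<le> \<sigma> * w a x"
  proof -
    have "(\<forall>x\<in>\<Delta>. 0 \<le> 1 * w a x) \<or> (\<forall>x\<in>\<Delta>. 0 \<le> -1 * w a x)"
      using sign a by (auto simp: no_sign_change_on_def)
    then show ?thesis using that[of 1] that[of "-1"] by blast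
  qed
  define K where "K = (\<Sum>k\<le>j. C k * \<bar>L j (B k)\<bar>)"
  have "AE x in M. \<sigma> * w a x \<noteq> 0 \<longrightarrow> \<bar>x\<bar> \<le> lam"
  proof (rule AE_support_of_moment_bound[OF _ _ lam _ id_measurable, where C = K])
    show "integrable M (\<lambda>x. x ^ k * (\<sigma> * w a x))" for k
    proof -
      have "integrable M (\<lambda>x. x ^ k * w a x)" using int_w a by blast
      from integrable_mult_right[OF this, of \<sigma>] show ?thesis by (simp add: mult_ac)
    qed
    show "0 \<le> \<sigma> * w a x" if "x \<in> space M" for x using \<sigma>(2) that by (simp add: space_M)
    show "(\<integral>x. x ^ r * (\<sigma> * w a x) \<partial>M) \<le> K * lam ^ r" for r
    proof -
      have "(\<integral>x. x ^ r * (\<sigma> * w a x) \<partial>M) = (\<integral>x. \<sigma> * (x ^ r * w a x) \<partial>M)"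
        by (simp add: mult_ac)
      also have "\<dots> = \<sigma> * (\<integral>x. x ^ r * w a x \<partial>M)" by simp
      also have "\<dots> \<le> \<bar>L j (monom 1 r)\<bar>" using eps \<sigma>(1) by (auto simp: L)
      also have "\<dots> \<le> K * lam ^ r" unfolding K_def by (rule moment_bound[OF bound])
      finally show ?thesis .
    qed
  qed
  then show ?thesis using \<sigma>(1) by auto
qed

text \<open>Growth bounds on row 0 of J^r confine all weights to [-lam, lam], hence every product
  B^(n) Q^(m), and the geometric series applies for all n and m.\<close>

lemma J_pow_gf:
  assumes lam: "0 < lam" and s: "cmod s < 1"
    and bound: "\<And>r k. \<bar>J_pow r 0 k\<bar> \<le> C k * lam ^ r"
  shows "(\<lambda>r. complex_of_real (J_pow r n m / lam ^ r) * s ^ r) sums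
    sint \<epsilon> M (\<lambda>x. complex_of_real (poly (B n) x * Q m x)
      / (1 - s / complex_of_real lam * complex_of_real x))"
proof -
  have "AE x in M. \<forall>a\<in>{1..p}. w a x \<noteq> 0 \<longrightarrow> \<bar>x\<bar> \<le> lam"
    using AE_weight_support[OF _ lam bound] by (intro AE_ball_countable[THEN iffD2]) auto
  then have "AE x in M. poly (B n) x * Q m x \<noteq> 0 \<longrightarrow> \<bar>x\<bar> \<le> lam"
  proof (rule AE_mp, intro AE_I2 impI)
    fix x assume x: "\<forall>a\<in>{1..p}. w a x \<noteq> 0 \<longrightarrow> \<bar>x\<bar> \<le> lam" "poly (B n) x * Q m x \<noteq> 0"
    show "\<bar>x\<bar> \<le> lam"
    proof (rule ccontr)
      assume "\<not> \<bar>x\<bar> \<le> lam"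
      then have "Q m x = 0" unfolding typeI_Q_def using x(1) by (intro sum.neutral) auto
      then show False using x(2) by simp
    qed
  qed
  moreover have "integrable M (\<lambda>x. x ^ r * (poly (B n) x * Q m x))" for r
    using integrable_poly_Q[of "monom 1 r * B n" m] by (simp add: poly_monom mult.assoc)
  ultimately have "(\<lambda>r. complex_of_real ((\<integral>x. x ^ r * (poly (B n) x * Q m x) \<partial>M) / lam ^ r) * s ^ r) sums
    (\<integral>x. complex_of_real (poly (B n) x * Q m x) / (1 - s / complex_of_real lam * complex_of_real x) \<partial>M)"
    by (intro geometric_integral_sums[OF _ lam s _ id_measurable])
  from sums_mult[OF this, of "complex_of_real \<epsilon>"] show ?thesis
    by (simp add: J_pow_eq sint_def scaleR_conv_of_real mult.assoc)
qed

text \<open>Serves both chains. The functions \<open>i\<close> and \<open>j\<close> locate row 0 of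
  J^r within P^r: at (0, k) for \<open>P_II\<close>, at (k, 0) for the transposed
  \<open>P_I\<close>. Entries of P^r being at most 1, they give the growth bound.\<close>

lemma transition_gf_eq:
  assumes lam: "0 < lam" and s: "cmod s < 1" and st: "stochastic P"
    and \<rho>: "\<And>n m. \<rho> n m \<noteq> 0"
    and bound: "\<And>r k. imat_pow P r (i k) (j k) = \<rho> (i k) (j k) * (J_pow r 0 k / lam ^ r)"
    and eq: "\<And>r. imat_pow P r n m = \<rho> n m * (J_pow r n' m' / lam ^ r)"
  shows "transition_gf P n m s = complex_of_real (\<rho> n m) *
    sint \<epsilon> M (\<lambda>x. complex_of_real (poly (B n') x * Q m' x)
      / (1 - s / complex_of_real lam * complex_of_real x))"
proof -
  have b: "\<bar>J_pow r 0 k\<bar> \<le> inverse \<bar>\<rho> (i k) (j k)\<bar> * lam ^ r" for r k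
  proof -
    have "\<bar>\<rho> (i k) (j k) * (J_pow r 0 k / lam ^ r)\<bar> \<le> 1"
      unfolding bound[symmetric] using imat_pow_bounds[OF st] by simp
    then show ?thesis using \<rho>[of "i k" "j k"] lam by (simp add: abs_mult field_simps)
  qed
  have "(\<lambda>r. complex_of_real (imat_pow P r n m) * s ^ r) sums
    (complex_of_real (\<rho> n m) * sint \<epsilon> M (\<lambda>x. complex_of_real (poly (B n') x * Q m' x)
      / (1 - s / complex_of_real lam * complex_of_real x)))"
    using sums_mult[OF J_pow_gf[OF lam s b, of n' m'], of "complex_of_real (\<rho> n m)"]
    unfolding eq by (simp add: mult.assoc)
  then show ?thesis unfolding transition_gf_def by (rule sums_unique[symmetric])
qed

end

section \<open>Position of lam relative to the zeros\<close>

lemma sup_abs_ge: "z \<in> Z \<Longrightarrow> ereal (cmod z) \<le> sup_abs Z"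
  unfolding sup_abs_def by (rule SUP_upper)

text \<open>A nonnegative real element at or above the supremum of the moduli equals that supremum,
  which is excluded from the set.\<close>

lemma not_mem_of_ge_sup_abs:
  assumes "sup_abs Z \<notin> ereal ` {x. complex_of_real x \<in> Z}" "sup_abs Z \<le> ereal x" "0 \<le> x"
  shows "complex_of_real x \<notin> Z"
proof
  assume x: "complex_of_real x \<in> Z"
  then have "sup_abs Z = ereal x" using sup_abs_ge[OF x] assms(2,3) by simp
  then show False using assms(1) x by auto
qed

text \<open>The polynomial is positive far to the right, and a negative value at lam would force a
  zero in between.\<close>

lemma poly_pos_of_no_zeros_above:
  fixes f :: "real poly"
  assumes "0 < lead_coeff f" "\<And>x. lam \<le> x \<Longrightarrow> poly f x \<noteq> 0"
  shows "0 < poly f lam"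
proof (rule ccontr)
  assume "\<not> 0 < poly f lam"
  then have neg: "poly f lam < 0" using assms(2)[of lam] by simp
  obtain N where N: "\<And>x. N \<le> x \<Longrightarrow> lead_coeff f \<le> poly f x"
    using poly_pinfty_gt_lc[OF assms(1)] by blast
  let ?b = "max N (lam + 1)"
  have "0 < poly f ?b" using N[of ?b] assms(1) by simp
  moreover have "lam < ?b" by simp
  ultimately obtain x where "lam < x" "poly f x = 0" using poly_IVT_pos[of lam ?b f] neg by blast
  then show False using assms(2)[of x] by simp
qed

lemma poly_map_of_real:
  "poly (map_poly complex_of_real f) (complex_of_real x) = complex_of_real (poly f x)"
  by (induction f) (simp_all add: map_poly_pCons)

lemma zeros_B_of_real: "poly (B n) x = 0 \<Longrightarrow> complex_of_real x \<in> zeros_B B"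
  unfolding zeros_B_def by (auto simp: poly_map_of_real intro!: exI[of _ n])

theorem theorem7:
  fixes \<Delta> :: "real set" and \<epsilon> :: real and M :: "real measure"
    and p :: nat and nv :: "nat \<Rightarrow> nat" and w :: "nat \<Rightarrow> real \<Rightarrow> real"
    and wc :: "nat \<Rightarrow> complex \<Rightarrow> complex" and D :: "complex set"
    and B :: "nat \<Rightarrow> real poly" and A :: "nat \<Rightarrow> nat \<Rightarrow> real poly"
    and Q :: "nat \<Rightarrow> real \<Rightarrow> real"
    and G :: "real \<Rightarrow> nat \<Rightarrow> nat \<Rightarrow> complex \<Rightarrow> complex"
  assumes "is_interval \<Delta>"
    and "\<epsilon> = 1 \<or> \<epsilon> = -1"
    and "sets M = sets (restrict_space borel \<Delta>)" and "finite_measure M"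
    and "infinite (msupport M)"
    and "1 \<le> p" and "\<forall>a\<in>{1..p}. 1 \<le> nv a"
    and "\<forall>a\<in>{1..p}. \<forall>k. integrable M (\<lambda>x. x ^ k * w a x)"
    and "\<forall>a\<in>{1..p}. no_sign_change_on \<Delta> (w a)"
    and "complex_of_real ` \<Delta> \<subseteq> D"
    and "\<forall>a\<in>{1..p}. \<forall>x. complex_of_real x \<in> D \<longrightarrow> wc a (complex_of_real x) = complex_of_real (w a x)"
    and "perfect \<epsilon> M p w"
    and "B = typeII_B \<epsilon> M p nv w"
    and "A = typeI_A \<epsilon> M p nv w"
    and "Q = typeI_Q \<epsilon> M p nv w"
    and "G = (\<lambda>lam n m s. sint \<epsilon> M (\<lambda>x. complex_of_real (poly (B n) x * Q m x)
                / (1 - s / complex_of_real lam * complex_of_real x)))"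
    and "\<forall>n m. 0 \<le> Jacobi B n m"
  shows
    "(sup_abs (zeros_B B) < \<infinity> \<and>
      sup_abs (zeros_B B) \<notin> ereal ` {x. complex_of_real x \<in> zeros_B B} \<longrightarrow>
      (\<forall>lam. ereal lam \<ge> sup_abs (zeros_B B) \<longrightarrow>
        (\<forall>n m s. cmod s < 1 \<longrightarrow>
           transition_gf (P_II B lam) n m s = poly (B m) lam / poly (B n) lam * G lam n m s) \<and>
        (\<forall>(\<Omega> :: 'a measure) X n m s.
           markov_chain \<Omega> X (P_II B lam) \<and> \<P>(\<omega> in \<Omega>. X 0 \<omega> = n) > 0 \<and> cmod s < 1 \<longrightarrow>
           first_passage_gf \<Omega> X n m s =
             (if n \<noteq> m then poly (B m) lam / poly (B n) lam * (G lam n m s / G lam m m s)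
              else 1 - 1 / G lam n n s))))
     \<and>
     (sup_abs (zeros_Q p A wc D) < \<infinity> \<and>
      sup_abs (zeros_Q p A wc D) \<notin> ereal ` {x. complex_of_real x \<in> zeros_Q p A wc D} \<and>
      (\<forall>n. filterlim (Q n) at_top at_top) \<longrightarrow>
      (\<forall>lam. ereal lam \<ge> max (sup_abs (zeros_Q p A wc D)) 0 \<and>
           complex_of_real ` {lam..} \<subseteq> D \<and> stochastic (P_I B Q lam) \<longrightarrow>
        (\<forall>n m s. cmod s < 1 \<longrightarrow>
           transition_gf (P_I B Q lam) n m s = Q m lam / Q n lam * G lam m n s) \<and>
        (\<forall>(\<Omega> :: 'a measure) X n m s.
           markov_chain \<Omega> X (P_I B Q lam) \<and> \<P>(\<omega> in \<Omega>. X 0 \<omega> = n) > 0 \<and> cmod s < 1 \<longrightarrow>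
           first_passage_gf \<Omega> X n m s =
             (if n \<noteq> m then Q m lam / Q n lam * (G lam m n s / G lam m m s)
              else 1 - 1 / G lam n n s))))"
proof (intro conjI impI allI)
  interpret mop: mop_system \<Delta> \<epsilon> M p nv w
    by (rule mop_system.intro[OF assms(2,3,6-9,12)])
  have B: "B = mop.B" using assms(13) mop.typeII_B_eq by simp
  have Q: "Q = mop.Q" using assms(15) by simp
  note G = assms(16)
  have J: "0 \<le> Jacobi B n m" for n m using assms(17) by blast
  {
    fix lam
    assume "sup_abs (zeros_B B) < \<infinity> \<and>
      sup_abs (zeros_B B) \<notin> ereal ` {x. complex_of_real x \<in> zeros_B B}"
      and ge: "sup_abs (zeros_B B) \<le> ereal lam"
    then have notin: "sup_abs (zeros_B B) \<notin> ereal ` {x. complex_of_real x \<in> zeros_B B}" by simp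
    have no_zero: "poly (B n) x \<noteq> 0" if "lam \<le> x" "0 \<le> x" for n x
      using not_mem_of_ge_sup_abs[OF notin order_trans[OF ge] that(2)] zeros_B_of_real[of B n x] that(1)
      by auto
    \<comment> \<open>B^(1) = x + b has the zero -b, so lam >= |b| >= 0. If lam = 0, then b = 0, and
      0 would be a zero at the excluded supremum.\<close>
    have lam: "0 < lam"
    proof (rule ccontr)
      assume "\<not> 0 < lam"
      define b where "b = coeff (B 1) 0"
      have z: "poly (B 1) (- b) = 0"
        using mop.degree_B[of 1] mop.coeff_B[of 1] unfolding b_def B by (simp add: poly_altdef)
      have "ereal (cmod (complex_of_real (- b))) \<le> ereal lam"
        using sup_abs_ge[OF zeros_B_of_real[of B 1, OF z]] ge by (rule order_trans)
      then have "- b = 0" "lam = 0" using \<open>\<not> 0 < lam\<close> by auto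
      then show False using no_zero[of 0 1] z by simp
    qed
    have pos: "0 < poly (B n) lam" for n
      using no_zero lam mop.degree_B[of n] mop.coeff_B[of n] unfolding B
      by (intro poly_pos_of_no_zeros_above) auto
    then have nz: "poly (B n) lam \<noteq> 0" for n by (metis less_irrefl)
    have st: "stochastic (P_II B lam)"
      using J lam pos unfolding B by (intro mop.stochastic_P_II)
    have gf: "transition_gf (P_II B lam) n m s = poly (B m) lam / poly (B n) lam * G lam n m s"
      if "cmod s < 1" for n m s
      unfolding G Q
      using mop.transition_gf_eq[OF lam that st, where \<rho> = "\<lambda>n m. poly (B m) lam / poly (B n) lam"
          and i = "\<lambda>_. 0" and j = "\<lambda>k. k" and n = n and m = m and n' = n and m' = m]
        mop.imat_pow_P_II[of lam] nz unfolding B by simp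
    show "transition_gf (P_II B lam) n m s = poly (B m) lam / poly (B n) lam * G lam n m s"
      if "cmod s < 1" for n m s using gf that .
    show "first_passage_gf \<Omega> X n m s =
             (if n \<noteq> m then poly (B m) lam / poly (B n) lam * (G lam n m s / G lam m m s)
              else 1 - 1 / G lam n n s)"
      if "markov_chain \<Omega> X (P_II B lam) \<and> \<P>(\<omega> in \<Omega>. X 0 \<omega> = n) > 0 \<and> cmod s < 1"
      for \<Omega> :: "'a measure" and X n m s
      using first_passage_gf_eq[of \<Omega> X "P_II B lam" n s m] that st gf[of s] nz by simp
  }
  {
    fix lam
    assume "sup_abs (zeros_Q p A wc D) < \<infinity> \<and>
      sup_abs (zeros_Q p A wc D) \<notin> ereal ` {x. complex_of_real x \<in> zeros_Q p A wc D} \<and>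
      (\<forall>n. filterlim (Q n) at_top at_top)"
      and "ereal lam \<ge> max (sup_abs (zeros_Q p A wc D)) 0 \<and>
           complex_of_real ` {lam..} \<subseteq> D \<and> stochastic (P_I B Q lam)"
    then have notin: "sup_abs (zeros_Q p A wc D) \<notin> ereal ` {x. complex_of_real x \<in> zeros_Q p A wc D}"
      and ge: "sup_abs (zeros_Q p A wc D) \<le> ereal lam" and lam0: "0 \<le> lam"
      and D: "complex_of_real lam \<in> D" and st: "stochastic (P_I B Q lam)" by auto
    \<comment> \<open>Since 1 / 0 = 0, the matrix would be zero for lam = 0, contradicting row sums
      1.\<close>
    have "lam \<noteq> 0"
    proof
      assume "lam = 0"
      then have "P_I B Q lam 0 = (\<lambda>_. 0)" by (simp add: P_I_def scaled_conj_def fun_eq_iff)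
      moreover have "P_I B Q lam 0 sums 1" using st by (simp add: stochastic_def)
      ultimately show False using sums_unique2[OF sums_zero] by fastforce
    qed
    with lam0 have lam: "0 < lam" by simp
    \<comment> \<open>As lam lies in \<open>D\<close>, where \<open>wc\<close> extends the real
      weights, a real zero of Q^(n) at lam would be an element of the complex zero set.\<close>
    have nz: "Q n lam \<noteq> 0" for n
    proof
      assume "Q n lam = 0"
      moreover have "(\<Sum>a=1..p. poly (map_poly complex_of_real (A n a)) (complex_of_real lam)
          * wc a (complex_of_real lam)) = complex_of_real (Q n lam)"
        unfolding assms(14,15) typeI_Q_def of_real_sum
        using assms(11) D by (intro sum.cong) (auto simp: poly_map_of_real)
      ultimately have "complex_of_real lam \<in> zeros_Q p A wc D"
        using D by (auto simp: zeros_Q_def)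
      then show False using not_mem_of_ge_sup_abs[OF notin ge lam0] by simp
    qed
    have gf: "transition_gf (P_I B Q lam) n m s = Q m lam / Q n lam * G lam m n s"
      if "cmod s < 1" for n m s
      unfolding G
      using mop.transition_gf_eq[OF lam that st, where \<rho> = "\<lambda>n m. Q m lam / Q n lam"
          and i = "\<lambda>k. k" and j = "\<lambda>_. 0" and n = n and m = m and n' = m and m' = n]
        mop.imat_pow_P_I[of Q lam] nz unfolding B Q by simp
    show "transition_gf (P_I B Q lam) n m s = Q m lam / Q n lam * G lam m n s"
      if "cmod s < 1" for n m s using gf that .
    show "first_passage_gf \<Omega> X n m s =
             (if n \<noteq> m then Q m lam / Q n lam * (G lam m n s / G lam m m s)
              else 1 - 1 / G lam n n s)"
      if "markov_chain \<Omega> X (P_I B Q lam) \<and> \<P>(\<omega> in \<Omega>. X 0 \<omega> = n) > 0 \<and> cmod s < 1"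
      for \<Omega> :: "'a measure" and X n m s
      using first_passage_gf_eq[of \<Omega> X "P_I B Q lam" n s m] that st gf[of s] nz by simp
  }
qed

end
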